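(* Let $G=G(\mathcal V,\mathcal E)$ and $G'=G(\mathcal V',\mathcal E')$ be finite strongly connected directed graphs, not cycles, such that for each of them (written for $G$) the semigroup $\mathcal S(MD(G))$ is the graph inverse semigroup of a two-vertex graph, and the graph $G(\mathcal V,\mathcal F_G)$ decomposes into a one-edge tree and a one-vertex tree (so that $G$ has three vertices). If the Markov-Dyck shifts $MD(G)$ and $MD(G')$ are topologically conjugate, then the graphs $G$ and $G'$ are isomorphic.
   Context: Graphs are finite directed graphs $G=G(\mathcal V,\mathcal E)$ (loops and multiple edges allowed) with source map $s$ and target map $t$. Graph inverse semigroup $\mathcal S(G)$: the semigroup with zero generated by $\mathbf 1_V$ ($V\in\mathcal V$), $e^-,e^+$ ($e\in\mathcal E$), with relations $\mathbf 1_V^2=\mathbf 1_V$, $\mathbf 1_U\mathbf 1_W=0$ for $U\ne W$, $f^-f^+=\mathbf 1_{s(f)}$, $f^-g^+=0$ for $f\neq g$, $\mathbf 1_{s(f)}f^-=f^-=f^-\mathbf 1_{t(f)}$, $\mathbf 1_{t(f)}f^+=f^+=f^+\mathbf 1_{s(f)}$. Markov-Dyck shift $MD(G)$: the subshift with alphabet $\{e^-,e^+:e\in\mathcal E\}$ in which a word is admissible precisely if its product in $\mathcal S(G)$ is not $0$. A topological conjugacy is a shift-commuting homeomorphism. $\mathcal F_G$ is the set of edges that are the only incoming edge of their target vertex; $\mathcal R_G$ is the set of vertices with at least two incoming edges. $G(\mathcal V,\mathcal F_G)$ is a disjoint union of directed trees with set of roots $\mathcal R_G$ (a tree may consist of a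 single vertex). $\widehat G$ is the graph with vertex set $\mathcal R_G$ obtained by contracting each of these trees to its root; its edges are $\widehat e$, $e\in\mathcal E\setminus\mathcal F_G$, with $t(\widehat e)=t(e)$ and $s(\widehat e)$ the root of the tree containing $s(e)$. The semigroup that is invariantly associated to $MD(G)$ is $\mathcal S(MD(G))=\mathcal S(\widehat G)$; thus the hypothesis on $\mathcal S(MD(G))$ says that $\widehat G$ has two vertices. *)

theory Defs
  imports "HOL-Analysis.Function_Topology" "Graph_Theory.Graph_Theory"
begin

text \<open>
  Finite directed graphs with loops and multiple edges are the structures satisfying
  \<^term>\<open>fin_digraph\<close>; the source map is \<^term>\<open>tail\<close> and the target map is \<^term>\<open>head\<close>.
\<close>

record 'a zero_semigroup =
  sg_carrier :: "'a set"
  sg_mult :: "'a \<Rightarrow> 'a \<Rightarrow> 'a"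
  sg_zero :: 'a

definition sg_iso :: "'a zero_semigroup \<Rightarrow> 'b zero_semigroup \<Rightarrow> bool" where
  "sg_iso S T \<longleftrightarrow> (\<exists>h. bij_betw h (sg_carrier S) (sg_carrier T) \<and> h (sg_zero S) = sg_zero T \<and>
     (\<forall>x \<in> sg_carrier S. \<forall>y \<in> sg_carrier S. h (sg_mult S x y) = sg_mult T (h x) (h y)))"

text \<open>
  The semigroup with zero is presented by generators and relations: its elements are the
  classes of nonempty words in the generators \<open>1\<^sub>V\<close>, \<open>e\<^sup>-\<close>, \<open>e\<^sup>+\<close> and an additional
  generator \<open>Zero\<close>, modulo the smallest congruence that contains the defining relations and
  makes \<open>Zero\<close> absorbing.
\<close>

datatype ('v, 'e) gis_gen = Zero | Unit 'v | Minus 'e | Plus 'e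

definition gis_gens :: "('v, 'e) pre_digraph \<Rightarrow> ('v, 'e) gis_gen set" where
  "gis_gens G = {Zero} \<union> Unit ` verts G \<union> Minus ` arcs G \<union> Plus ` arcs G"

definition gis_words :: "('v, 'e) pre_digraph \<Rightarrow> ('v, 'e) gis_gen list set" where
  "gis_words G = lists (gis_gens G) - {[]}"

inductive gis_rel :: "('v, 'e) pre_digraph \<Rightarrow> ('v, 'e) gis_gen list \<Rightarrow> ('v, 'e) gis_gen list \<Rightarrow> bool"
  for G where
  zero_left: "x \<in> gis_gens G \<Longrightarrow> gis_rel G [Zero, x] [Zero]"
| zero_right: "x \<in> gis_gens G \<Longrightarrow> gis_rel G [x, Zero] [Zero]"
| unit_idem: "V \<in> verts G \<Longrightarrow> gis_rel G [Unit V, Unit V] [Unit V]"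
| unit_orth: "U \<in> verts G \<Longrightarrow> W \<in> verts G \<Longrightarrow> U \<noteq> W \<Longrightarrow> gis_rel G [Unit U, Unit W] [Zero]"
| minus_plus_same: "f \<in> arcs G \<Longrightarrow> gis_rel G [Minus f, Plus f] [Unit (tail G f)]"
| minus_plus_diff: "f \<in> arcs G \<Longrightarrow> g \<in> arcs G \<Longrightarrow> f \<noteq> g \<Longrightarrow> gis_rel G [Minus f, Plus g] [Zero]"
| minus_left: "f \<in> arcs G \<Longrightarrow> gis_rel G [Unit (tail G f), Minus f] [Minus f]"
| minus_right: "f \<in> arcs G \<Longrightarrow> gis_rel G [Minus f, Unit (head G f)] [Minus f]"
| plus_left: "f \<in> arcs G \<Longrightarrow> gis_rel G [Unit (head G f), Plus f] [Plus f]"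
| plus_right: "f \<in> arcs G \<Longrightarrow> gis_rel G [Plus f, Unit (tail G f)] [Plus f]"

inductive gis_cong :: "('v, 'e) pre_digraph \<Rightarrow> ('v, 'e) gis_gen list \<Rightarrow> ('v, 'e) gis_gen list \<Rightarrow> bool"
  for G where
  base: "gis_rel G x y \<Longrightarrow> gis_cong G x y"
| refl: "x \<in> gis_words G \<Longrightarrow> gis_cong G x x"
| sym: "gis_cong G x y \<Longrightarrow> gis_cong G y x"
| trans: "gis_cong G x y \<Longrightarrow> gis_cong G y z \<Longrightarrow> gis_cong G x z"
| left: "u \<in> gis_words G \<Longrightarrow> gis_cong G x y \<Longrightarrow> gis_cong G (u @ x) (u @ y)"
| right: "u \<in> gis_words G \<Longrightarrow> gis_cong G x y \<Longrightarrow> gis_cong G (x @ u) (y @ u)"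

text \<open>The class of a word is the product in the semigroup of the generators in that word.\<close>

definition gis_class :: "('v, 'e) pre_digraph \<Rightarrow> ('v, 'e) gis_gen list \<Rightarrow> ('v, 'e) gis_gen list set" where
  "gis_class G w = {u. gis_cong G w u}"

definition graph_inverse_semigroup ::
    "('v, 'e) pre_digraph \<Rightarrow> ('v, 'e) gis_gen list set zero_semigroup" where
  "graph_inverse_semigroup G =
     \<lparr> sg_carrier = gis_class G ` gis_words G,
       sg_mult = (\<lambda>A B. \<Union>a \<in> A. \<Union>b \<in> B. gis_class G (a @ b)),
       sg_zero = gis_class G [Zero] \<rparr>"

definition md_alphabet :: "('v, 'e) pre_digraph \<Rightarrow> ('v, 'e) gis_gen set" where
  "md_alphabet G = Minus ` arcs G \<union> Plus ` arcs G"

definition md_admissible :: "('v, 'e) pre_digraph \<Rightarrow> ('v, 'e) gis_gen list \<Rightarrow> bool" where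
  "md_admissible G w \<longleftrightarrow> gis_class G w \<noteq> sg_zero (graph_inverse_semigroup G)"

definition MD :: "('v, 'e) pre_digraph \<Rightarrow> (int \<Rightarrow> ('v, 'e) gis_gen) set" where
  "MD G = {x. (\<forall>i. x i \<in> md_alphabet G) \<and> (\<forall>i j. i \<le> j \<longrightarrow> md_admissible G (map x [i..j]))}"

definition shift :: "(int \<Rightarrow> 'a) \<Rightarrow> int \<Rightarrow> 'a" where
  "shift x = (\<lambda>i. x (i + 1))"

definition shift_topology :: "(int \<Rightarrow> 'a) set \<Rightarrow> (int \<Rightarrow> 'a) topology" where
  "shift_topology X = subtopology (product_topology (\<lambda>_. discrete_topology UNIV) UNIV) X"

definition topologically_conjugate :: "(int \<Rightarrow> 'a) set \<Rightarrow> (int \<Rightarrow> 'b) set \<Rightarrow> bool" where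
  "topologically_conjugate X Y \<longleftrightarrow>
     (\<exists>\<phi>. homeomorphic_map (shift_topology X) (shift_topology Y) \<phi> \<and>
          (\<forall>x \<in> X. \<phi> (shift x) = shift (\<phi> x)))"

definition F_edges :: "('v, 'e) pre_digraph \<Rightarrow> 'e set" where
  "F_edges G = {e \<in> arcs G. in_arcs G (head G e) = {e}}"

definition R_verts :: "('v, 'e) pre_digraph \<Rightarrow> 'v set" where
  "R_verts G = {v \<in> verts G. 2 \<le> in_degree G v}"

definition F_graph :: "('v, 'e) pre_digraph \<Rightarrow> ('v, 'e) pre_digraph" where
  "F_graph G = G\<lparr>arcs := F_edges G\<rparr>"

definition tree_root :: "('v, 'e) pre_digraph \<Rightarrow> 'v \<Rightarrow> 'v" where
  "tree_root G v = (THE r. r \<in> R_verts G \<and> r \<rightarrow>\<^sup>*\<^bsub>F_graph G\<^esub> v)"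

definition contraction :: "('v, 'e) pre_digraph \<Rightarrow> ('v, 'e) pre_digraph" where
  "contraction G = \<lparr> verts = R_verts G, arcs = arcs G - F_edges G,
                     tail = (\<lambda>e. tree_root G (tail G e)), head = head G \<rparr>"

definition MD_semigroup :: "('v, 'e) pre_digraph \<Rightarrow> ('v, 'e) gis_gen list set zero_semigroup" where
  "MD_semigroup G = graph_inverse_semigroup (contraction G)"

text \<open>
  Graphs over \<^typ>\<open>nat\<close> represent all finite graphs up to isomorphism.
\<close>

definition MD_semigroup_of_two_vertex_graph :: "('v, 'e) pre_digraph \<Rightarrow> bool" where
  "MD_semigroup_of_two_vertex_graph G \<longleftrightarrow>
     (\<exists>H :: (nat, nat) pre_digraph. fin_digraph H \<and> card (verts H) = 2 \<and>
        sg_iso (MD_semigroup G) (graph_inverse_semigroup H))"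

text \<open>
  The library's \<^term>\<open>tree\<close> does not exclude parallel edges, and asks for no root; a directed tree
  is a graph with a root from which every vertex is reached by exactly one walk.
\<close>

definition directed_tree :: "('v, 'e) pre_digraph \<Rightarrow> bool" where
  "directed_tree T \<longleftrightarrow> fin_digraph T \<and>
     (\<exists>r \<in> verts T. \<forall>v \<in> verts T. \<exists>!p. pre_digraph.awalk T r p v)"

definition one_edge_one_vertex_forest :: "('v, 'e) pre_digraph \<Rightarrow> bool" where
  "one_edge_one_vertex_forest F \<longleftrightarrow>
     (\<exists>T\<^sub>1 T\<^sub>2. subgraph T\<^sub>1 F \<and> subgraph T\<^sub>2 F \<and> directed_tree T\<^sub>1 \<and> directed_tree T\<^sub>2 \<and>
        verts T\<^sub>1 \<inter> verts T\<^sub>2 = {} \<and> verts T\<^sub>1 \<union> verts T\<^sub>2 = verts F \<and> arcs T\<^sub>1 \<union> arcs T\<^sub>2 = arcs F \<and>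
        card (arcs T\<^sub>1) = 1 \<and> card (verts T\<^sub>2) = 1)"

definition is_cycle_graph :: "('v, 'e) pre_digraph \<Rightarrow> bool" where
  "is_cycle_graph G \<longleftrightarrow>
     (\<exists>p. pre_digraph.cycle G p \<and> set p = arcs G \<and> tail G ` set p = verts G)"

end

theory Submission
  imports Defs
begin

text \<open>
  The graph \<open>G\<close> has a root \<open>r\<close> carrying the only edge \<open>f\<close> into a vertex \<open>c\<close>, and a further vertex
  \<open>w\<close>; up to isomorphism it is given by the six numbers of edges from \<open>r, c, w\<close> to \<open>r\<close> and to
  \<open>w\<close>, and these are read off from the shift. A conjugacy is a sliding block code, so it respects
  the gluing of two points along a long common run of a periodic point. This distinguishes the points
  \<open>\<dots> e\<^sup>- e\<^sup>+ e\<^sup>- e\<^sup>+ \<dots>\<close> among the points of period two, tells whether the sources of two edges lie in the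
  same tree, and counts the edges of the contracted graph between two trees. The edges starting in the
  tree of \<open>r\<close> exceed those of the contracted graph by one, namely \<open>f\<close>, while for \<open>w\<close> the two
  numbers agree, so the trees cannot be interchanged. The numbers of fixed points and of points of
  period two then separate the edges that start at \<open>r\<close> from those that start at \<open>c\<close>.
\<close>

section \<open>Conjugacies are sliding block codes\<close>

text \<open>The word \<open>e^- e^+\<close> acts as the identity on the states at the source of
  \<open>e\<close> and is undefined at all others. Hence a run of it may be lengthened or shortened
  freely, and gluing two points along such a run amounts to multiplying elements of the inverse
  semigroup. For points with such tails, inclusion between sets of possible continuations reflects
  the prefix order of stacks, which is how a conjugacy sees the contracted graph. The obstacle is
  \<open>f\<close>, which leaves no trace on the stack. Write uv for the number of edges from
  \<open>u\<close> to \<open>v\<close>. The contracted graph yields wr and ww, but of the other four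
  numbers only the sums rr + cr and rw + cw, so two equations are missing. The fixed points give rr
  + ww, hence rr and then cr. The points of period two outside \<open>neut\<close> give rr^2 + ww^2
  + 2 cr + 2 rw wr, hence the product of rw and wr. Strong connectedness makes wr positive, so rw
  and finally cw follow.\<close>

lemma openin_cylinder:
  assumes "finite J"
  shows "openin (product_topology (\<lambda>_. discrete_topology UNIV) UNIV) {y :: int \<Rightarrow> 'a. \<forall>i\<in>J. y i = x i}"
proof -
  have *: "{y :: int \<Rightarrow> 'a. \<forall>i\<in>J. y i = x i} = (\<Pi>\<^sub>E i\<in>UNIV. if i \<in> J then {x i} else UNIV)"
    by (auto simp: PiE_UNIV_domain Pi_def split: if_splits)
  have "{i. (if i \<in> J then {x i} else UNIV) \<noteq> (UNIV :: 'a set)} \<subseteq> J"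
    by auto
  then have "finite {i. (if i \<in> J then {x i} else UNIV) \<noteq> (UNIV :: 'a set)}"
    using assms finite_subset by blast
  then show ?thesis
    unfolding * by (subst openin_PiE_gen) auto
qed

lemma topspace_shift_topology [simp]: "topspace (shift_topology X) = X"
  by (simp add: shift_topology_def)

definition agree :: "nat \<Rightarrow> (int \<Rightarrow> 'a) \<Rightarrow> int \<Rightarrow> (int \<Rightarrow> 'a) \<Rightarrow> int \<Rightarrow> bool" where
  "agree r x m y n \<longleftrightarrow> (\<forall>i. \<bar>i\<bar> \<le> int r \<longrightarrow> x (m + i) = y (n + i))"

text \<open>Since the positions \<open>m\<close> and \<open>n\<close> may differ, commutation with
  the shift is built in.\<close>

definition block_code :: "(int \<Rightarrow> 'a) set \<Rightarrow> ((int \<Rightarrow> 'a) \<Rightarrow> (int \<Rightarrow> 'b)) \<Rightarrow> nat \<Rightarrow> bool" where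
  "block_code X \<phi> r \<longleftrightarrow> (\<forall>x\<in>X. \<forall>y\<in>X. \<forall>m n. agree r x m y n \<longrightarrow> \<phi> x m = \<phi> y n)"

lemma block_code_mono: "block_code X \<phi> r \<Longrightarrow> r \<le> s \<Longrightarrow> block_code X \<phi> s"
  unfolding block_code_def agree_def by fastforce

definition shift_by :: "int \<Rightarrow> (int \<Rightarrow> 'a) \<Rightarrow> int \<Rightarrow> 'a" where
  "shift_by n x = (\<lambda>i. x (i + n))"

definition shift_invariant :: "(int \<Rightarrow> 'a) set \<Rightarrow> bool" where
  "shift_invariant X \<longleftrightarrow> (\<forall>x\<in>X. \<forall>n. shift_by n x \<in> X)"

lemma shift_shift_by: "shift (shift_by n x) = shift_by (n + 1) x"
  by (simp add: shift_def shift_by_def algebra_simps)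

lemma commute_shift_by:
  assumes X: "shift_invariant X" and comm: "\<forall>x\<in>X. \<phi> (shift x) = shift (\<phi> x)" and "x \<in> X"
  shows "\<phi> (shift_by n x) = shift_by n (\<phi> x)"
proof -
  have step: "\<phi> (shift_by (k + 1) x) = shift (\<phi> (shift_by k x))" for k
    using comm X \<open>x \<in> X\<close> by (metis shift_invariant_def shift_shift_by)
  show ?thesis
  proof (induction n rule: int_induct[where k = 0])
    case base
    then show ?case by (simp add: shift_by_def)
  next
    case (step1 i)
    then show ?case by (simp add: step shift_shift_by)
  next
    case (step2 i)
    have "shift (\<phi> (shift_by (i - 1) x)) = shift_by i (\<phi> x)"
      using step[of "i - 1"] step2 by simp
    then have *: "\<phi> (shift_by (i - 1) x) (j + 1) = \<phi> x (j + i)" for j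
      by (simp add: shift_def shift_by_def fun_eq_iff)
    show ?case
      using *[of "j - 1" for j] by (simp add: shift_by_def fun_eq_iff algebra_simps)
  qed
qed

text \<open>The Curtis-Hedlund-Lyndon theorem. Around each point coordinate 0 of the image is
  constant on some cylinder; by compactness finitely many cylinders suffice, and the largest of
  their radii serves coordinate 0. Commutation with the shift carries this to all
  coordinates.\<close>

lemma continuous_imp_block_code:
  assumes cpt: "compact_space (shift_topology X)" and X: "shift_invariant X"
    and cont: "continuous_map (shift_topology X) (shift_topology Y) \<phi>"
    and comm: "\<forall>x\<in>X. \<phi> (shift x) = shift (\<phi> x)"
  shows "\<exists>r. block_code X \<phi> r"
proof -
  define U where "U x = {y \<in> X. \<phi> y 0 = \<phi> x 0}" for x
  have opU: "openin (shift_topology X) (U x)" if "x \<in> X" for x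
  proof -
    have "openin (shift_topology Y) ({y. \<forall>i\<in>{0}. y i = \<phi> x i} \<inter> Y)"
      unfolding shift_topology_def by (rule openin_subtopology_Int, rule openin_cylinder) simp
    from openin_continuous_map_preimage[OF cont this]
    have "openin (shift_topology X) {y \<in> X. \<phi> y \<in> {y. \<forall>i\<in>{0}. y i = \<phi> x i} \<inter> Y}"
      by simp
    moreover have "{y \<in> X. \<phi> y \<in> {y. \<forall>i\<in>{0}. y i = \<phi> x i} \<inter> Y} = U x"
      using continuous_map_funspace[OF cont] by (auto simp: U_def)
    ultimately show ?thesis by simp
  qed
  define cyl where "cyl x r = X \<inter> {y. \<forall>i\<in>{-int r..int r}. y i = x i}" for x :: "int \<Rightarrow> 'a" and r
  have ex: "\<exists>r. cyl x r \<subseteq> U x" if "x \<in> X" for x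
  proof -
    from opU[OF that] obtain T where T: "openin (product_topology (\<lambda>_. discrete_topology UNIV) UNIV) T"
      "U x = T \<inter> X"
      by (auto simp: shift_topology_def openin_subtopology)
    have "x \<in> T" using that T(2) by (auto simp: U_def)
    with T(1) obtain V where V: "finite {i. V i \<noteq> (UNIV :: 'a set)}" "x \<in> Pi\<^sub>E UNIV V" "Pi\<^sub>E UNIV V \<subseteq> T"
      unfolding openin_product_topology_alt by (metis (no_types, lifting) Collect_cong UNIV_I topspace_discrete_topology)
    obtain r where r: "{i. V i \<noteq> UNIV} \<subseteq> {-int r..int r}"
    proof -
      define R where "R = Max (insert 0 ((\<lambda>i. nat \<bar>i\<bar>) ` {i. V i \<noteq> UNIV}))"
      have "nat \<bar>i\<bar> \<le> R" if "V i \<noteq> UNIV" for i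
        unfolding R_def using V(1) that by (intro Max_ge) auto
      then have "{i. V i \<noteq> UNIV} \<subseteq> {-int R..int R}" by fastforce
      then show thesis using that by blast
    qed
    have "y \<in> T" if "y \<in> cyl x r" for y
    proof -
      have "y i \<in> V i" for i
      proof (cases "V i = UNIV")
        case False
        then have "y i = x i" using that r by (auto simp: cyl_def)
        then show ?thesis using V(2) by (auto simp: PiE_UNIV_domain)
      qed simp
      then show ?thesis using V(3) by (auto simp: PiE_UNIV_domain)
    qed
    then show ?thesis using T(2) by (auto simp: cyl_def)
  qed
  then obtain r where r: "\<And>x. x \<in> X \<Longrightarrow> cyl x (r x) \<subseteq> U x" by metis
  have "openin (shift_topology X) (cyl x (r x))" for x
    unfolding cyl_def shift_topology_def
    by (subst Int_commute, rule openin_subtopology_Int, rule openin_cylinder) simp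
  moreover have "X \<subseteq> (\<Union>x\<in>X. cyl x (r x))"
    by (auto simp: cyl_def)
  ultimately obtain F where F: "finite F" "F \<subseteq> (\<lambda>x. cyl x (r x)) ` X" "X \<subseteq> \<Union>F"
    using cpt unfolding compact_space_def compactin_def
    by (smt (verit, best) imageE topspace_shift_topology)
  from finite_subset_image[OF F(1,2)] obtain Q where Q: "Q \<subseteq> X" "finite Q" "F = (\<lambda>x. cyl x (r x)) ` Q"
    by blast
  \<comment> \<open>The inserted 0 keeps the maximum meaningful when \<open>X\<close>, and with it
    \<open>Q\<close>, is empty.\<close>
  define R where "R = Max (insert 0 (r ` Q))"
  have rR: "r q \<le> R" if "q \<in> Q" for q
    unfolding R_def using Q(2) that by (intro Max_ge) auto
  have zero: "\<phi> x 0 = \<phi> y 0" if x: "x \<in> X" and y: "y \<in> X" and xy: "\<And>i. \<bar>i\<bar> \<le> int R \<Longrightarrow> x i = y i" for x y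
  proof -
    from x F(3) Q(3) obtain q where q: "q \<in> Q" "x \<in> cyl q (r q)" by auto
    have "y \<in> cyl q (r q)"
      using q y xy rR[OF q(1)] unfolding cyl_def by fastforce
    then have "x \<in> U q" "y \<in> U q" using q r Q(1) by blast+
    then show ?thesis by (simp add: U_def)
  qed
  have "\<phi> x m = \<phi> y n" if "x \<in> X" "y \<in> X" "agree R x m y n" for x y m n
  proof -
    have "\<phi> (shift_by m x) 0 = \<phi> (shift_by n y) 0"
    proof (rule zero)
      show "shift_by m x \<in> X" "shift_by n y \<in> X" using X that by (auto simp: shift_invariant_def)
      show "shift_by m x i = shift_by n y i" if "\<bar>i\<bar> \<le> int R" for i
        using \<open>agree R x m y n\<close> that by (simp add: agree_def shift_by_def add.commute)
    qed
    then show ?thesis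
      using commute_shift_by[OF X comm] that by (simp add: shift_by_def)
  qed
  then show ?thesis unfolding block_code_def by blast
qed

text \<open>Sequences over a finite alphabet form a compact product, so closedness is enough;
  \<open>closed\<close> expresses it through central windows.\<close>

lemma compact_shift_topology:
  fixes X :: "(int \<Rightarrow> 'a) set"
  assumes A: "finite A" "\<And>x i. x \<in> X \<Longrightarrow> x i \<in> A"
    and closed: "\<And>x. (\<And>n. \<exists>y\<in>X. \<forall>i. \<bar>i\<bar> \<le> int n \<longrightarrow> y i = x i) \<Longrightarrow> x \<in> X"
  shows "compact_space (shift_topology X)"
proof -
  let ?P = "product_topology (\<lambda>_ :: int. discrete_topology (UNIV :: 'a set)) UNIV"
  have "compactin ?P (Pi\<^sub>E UNIV (\<lambda>_. A))"
    using A(1) by (simp add: compactin_PiE finite_imp_compactin)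
  moreover have "X \<subseteq> Pi\<^sub>E UNIV (\<lambda>_. A)"
    using A(2) by (auto simp: PiE_UNIV_domain)
  moreover have "closedin ?P X"
  proof -
    have "openin ?P (UNIV - X)"
    proof (subst openin_subopen, intro ballI)
      fix x assume "x \<in> UNIV - X"
      with closed[of x] obtain n where n: "\<And>y. y \<in> X \<Longrightarrow> \<exists>i. \<bar>i\<bar> \<le> int n \<and> y i \<noteq> x i"
        by blast
      have "openin ?P {y. \<forall>i\<in>{-int n..int n}. y i = x i}"
        by (rule openin_cylinder) simp
      moreover have "{y. \<forall>i\<in>{-int n..int n}. y i = x i} \<subseteq> UNIV - X"
        using n by (fastforce simp: abs_le_iff)
      ultimately show "\<exists>T. openin ?P T \<and> x \<in> T \<and> T \<subseteq> UNIV - X" by (intro exI conjI) auto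
    qed
    then show ?thesis by (simp add: closedin_def)
  qed
  ultimately have "compactin ?P X" by (rule closed_compactin)
  then show ?thesis
    by (simp add: compact_space_def shift_topology_def compactin_subtopology)
qed

section \<open>Conjugacy invariants\<close>

text \<open>The offset \<open>n\<close> is arbitrary, so only the orbit of \<open>p\<close> matters
  and \<open>p\<close> may be replaced by \<open>shift p\<close>.\<close>

definition left_asymp :: "(int \<Rightarrow> 'a) \<Rightarrow> (int \<Rightarrow> 'a) \<Rightarrow> bool" where
  "left_asymp p x \<longleftrightarrow> (\<exists>n K. \<forall>i\<le>K. x i = p (i + n))"

definition right_asymp :: "(int \<Rightarrow> 'a) \<Rightarrow> (int \<Rightarrow> 'a) \<Rightarrow> bool" where
  "right_asymp p x \<longleftrightarrow> (\<exists>n K. \<forall>i\<ge>K. x i = p (i + n))"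

text \<open>The seam is at 0: left of it stands \<open>x\<close> up to but excluding position
  \<open>N\<close>, from it on stands \<open>y\<close> starting at position \<open>- M\<close>. For
  large \<open>N\<close> and \<open>M\<close> it lies deep in the right tail of \<open>x\<close> and
  the left tail of \<open>y\<close>.\<close>

definition glue :: "(int \<Rightarrow> 'a) \<Rightarrow> int \<Rightarrow> (int \<Rightarrow> 'a) \<Rightarrow> int \<Rightarrow> int \<Rightarrow> 'a" where
  "glue x N y M = (\<lambda>i. if i < 0 then x (i + N) else y (i - M))"

text \<open>
  The windows around \<open>N\<close> and \<open>-M\<close> have to agree so that a block code cannot see the seam of the
  glued point; this makes composability invariant under conjugacy.
\<close>

definition composable :: "(int \<Rightarrow> 'a) set \<Rightarrow> (int \<Rightarrow> 'a) \<Rightarrow> (int \<Rightarrow> 'a) \<Rightarrow> bool" where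
  "composable X x y \<longleftrightarrow>
     (\<exists>K. \<forall>N\<ge>int K. \<forall>M\<ge>int K. agree K x N y (- M) \<longrightarrow> glue x N y M \<in> X)"

text \<open>
  In a Markov-Dyck shift these are the period-two points whose repeated word is an idempotent: if
  all brackets of \<open>p\<close> open (or all close), a long run of \<open>p\<close> separates its two sides.
\<close>

definition neut :: "(int \<Rightarrow> 'a) set \<Rightarrow> (int \<Rightarrow> 'a) set" where
  "neut X = {p \<in> X. shift (shift p) = p \<and>
     (\<exists>x\<in>X. \<exists>y\<in>X. left_asymp p x \<and> right_asymp p x \<and> left_asymp p y \<and> right_asymp p y \<and> \<not> composable X x y)}"

text \<open>No past ending in the run of \<open>p\<close> is forbidden before \<open>x\<close>. In a
  Markov-Dyck shift this singles out the points whose middle part opens brackets without closing any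
  that were open before; see \<open>pushes_imp_left_free\<close> and
  \<open>left_free_imp_pushes\<close>.\<close>

definition left_free :: "(int \<Rightarrow> 'a) set \<Rightarrow> (int \<Rightarrow> 'a) \<Rightarrow> (int \<Rightarrow> 'a) \<Rightarrow> bool" where
  "left_free X p x \<longleftrightarrow> (\<forall>u\<in>X. right_asymp p u \<longrightarrow> composable X u x)"

definition futures :: "(int \<Rightarrow> 'a) set \<Rightarrow> (int \<Rightarrow> 'a) \<Rightarrow> (int \<Rightarrow> 'a) set" where
  "futures X q = {y \<in> X. left_asymp q y}"

text \<open>A follower set in the manner of Myhill and Nerode: it remembers of \<open>x\<close> only
  what restricts the continuations, which for a left free point of a Markov-Dyck shift is the list
  of brackets left open.\<close>

definition nbhd :: "(int \<Rightarrow> 'a) set \<Rightarrow> (int \<Rightarrow> 'a) \<Rightarrow> (int \<Rightarrow> 'a) \<Rightarrow> (int \<Rightarrow> 'a) set" where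
  "nbhd X q x = {y \<in> X. left_asymp q y \<and> composable X x y}"

definition nbhds :: "(int \<Rightarrow> 'a) set \<Rightarrow> (int \<Rightarrow> 'a) \<Rightarrow> (int \<Rightarrow> 'a) \<Rightarrow> (int \<Rightarrow> 'a) set set" where
  "nbhds X p q = nbhd X q ` {x \<in> X. left_asymp p x \<and> right_asymp q x \<and> left_free X p x}"

text \<open>
  For Markov-Dyck shifts the neighbourhoods correspond to the walks of the contracted graph, a longer
  walk having a smaller neighbourhood. The empty walk gives \<open>futures\<close>, so the maximal proper
  neighbourhoods are the edges.
\<close>

definition arrows :: "(int \<Rightarrow> 'a) set \<Rightarrow> (int \<Rightarrow> 'a) \<Rightarrow> (int \<Rightarrow> 'a) \<Rightarrow> (int \<Rightarrow> 'a) set set" where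
  "arrows X p q = {S \<in> nbhds X p q. S \<noteq> futures X q \<and>
     (\<forall>p'\<in>neut X. \<forall>S'\<in>nbhds X p' q. S \<subset> S' \<longrightarrow> S' = futures X q)}"

text \<open>The full set of futures belongs to the empty walk, so this says that an empty walk of
  the contracted graph joins \<open>p\<close> to \<open>q\<close>.\<close>

definition eqv :: "(int \<Rightarrow> 'a) set \<Rightarrow> (int \<Rightarrow> 'a) \<Rightarrow> (int \<Rightarrow> 'a) \<Rightarrow> bool" where
  "eqv X p q \<longleftrightarrow> futures X q \<in> nbhds X p q"

section \<open>Invariance under mutually inverse block codes\<close>

locale shift_conj =
  fixes X :: "(int \<Rightarrow> 'a) set" and Y :: "(int \<Rightarrow> 'b) set" and \<phi> \<psi> r
  assumes fwd: "x \<in> X \<Longrightarrow> \<phi> x \<in> Y" and bwd: "y \<in> Y \<Longrightarrow> \<psi> y \<in> X"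
    and inv1: "x \<in> X \<Longrightarrow> \<psi> (\<phi> x) = x" and inv2: "y \<in> Y \<Longrightarrow> \<phi> (\<psi> y) = y"
    and code1: "block_code X \<phi> r" and code2: "block_code Y \<psi> r"
begin

text \<open>The locale is symmetric in the two shifts, so for each invariant one direction has to be
  shown and the other follows by exchanging them.\<close>

lemma swap: "shift_conj Y X \<psi> \<phi> r"
  by unfold_locales (use fwd bwd inv1 inv2 code1 code2 in auto)

lemma codeD: "x \<in> X \<Longrightarrow> y \<in> X \<Longrightarrow> agree r x m y n \<Longrightarrow> \<phi> x m = \<phi> y n"
  using code1 by (auto simp: block_code_def)

lemma image_X: "\<phi> ` X = Y"
  using fwd bwd inv2 by (metis image_eqI image_subsetI subsetI subset_antisym)

lemma inj: "inj_on \<phi> X"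
  by (metis inj_onI inv1)

lemma left_asymp_fwd:
  assumes "p \<in> X" "x \<in> X" "left_asymp p x" shows "left_asymp (\<phi> p) (\<phi> x)"
proof -
  obtain n K where nK: "\<And>i. i \<le> K \<Longrightarrow> x i = p (i + n)" using assms(3) by (auto simp: left_asymp_def)
  have "\<phi> x i = \<phi> p (i + n)" if "i \<le> K - int r" for i
    by (rule codeD) (use assms that nK in \<open>auto simp: agree_def algebra_simps\<close>)
  then show ?thesis by (auto simp: left_asymp_def)
qed

lemma right_asymp_fwd:
  assumes "p \<in> X" "x \<in> X" "right_asymp p x" shows "right_asymp (\<phi> p) (\<phi> x)"
proof -
  obtain n K where nK: "\<And>i. i \<ge> K \<Longrightarrow> x i = p (i + n)" using assms(3) by (auto simp: right_asymp_def)
  have "\<phi> x i = \<phi> p (i + n)" if "i \<ge> K + int r" for i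
    by (rule codeD) (use assms that nK in \<open>auto simp: agree_def algebra_simps\<close>)
  then show ?thesis by (auto simp: right_asymp_def)
qed

lemma shift2_fwd:
  assumes "p \<in> X" "shift (shift p) = p" shows "shift (shift (\<phi> p)) = \<phi> p"
proof -
  have "p (i + 2) = p i" for i
    using fun_cong[OF assms(2), of i] by (simp add: shift_def add.assoc)
  then have "p (i + 2 + j) = p (i + j)" for i j
    by (metis add.commute add.left_commute)
  then have "agree r p (i + 2) p i" for i
    by (simp add: agree_def)
  then show ?thesis
    using codeD[OF assms(1) assms(1)] by (auto simp: shift_def fun_eq_iff add.assoc)
qed

lemma shift_fwd:
  assumes "p \<in> X" "shift p = p" shows "shift (\<phi> p) = \<phi> p"
proof -
  have "p (i + 1) = p i" for i
    using fun_cong[OF assms(2), of i] by (simp add: shift_def)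
  then have "p (i + 1 + j) = p (i + j)" for i j
    by (metis add.commute add.left_commute)
  then have "agree r p (i + 1) p i" for i
    by (simp add: agree_def)
  then show ?thesis
    using codeD[OF assms(1) assms(1)] by (auto simp: shift_def fun_eq_iff)
qed

text \<open>The glued images are the image of a glued point. Decoding with \<open>\<psi>\<close>
  shows that \<open>x\<close> and \<open>y\<close> agree around the intended seam, and a window that
  straddles the seam reads the same from either of them, so the code does not notice it.\<close>

lemma composable_fwd:
  assumes x: "x \<in> X" and y: "y \<in> X" and "composable X x y"
  shows "composable Y (\<phi> x) (\<phi> y)"
proof -
  obtain K where K: "\<And>N M. N \<ge> int K \<Longrightarrow> M \<ge> int K \<Longrightarrow> agree K x N y (- M) \<Longrightarrow> glue x N y M \<in> X"
    using assms(3) by (auto simp: composable_def)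
  \<comment> \<open>One \<open>r\<close> of the additional radius is lost in decoding; the other is
    the margin for windows of \<open>\<phi>\<close> that cross the seam.\<close>
  have "glue (\<phi> x) N (\<phi> y) M \<in> Y"
    if N: "N \<ge> int (K + 2 * r)" and M: "M \<ge> int (K + 2 * r)" and ag: "agree (K + 2 * r) (\<phi> x) N (\<phi> y) (- M)" for N M
  proof -
    have ag': "agree (K + r) x N y (- M)"
      unfolding agree_def
    proof (intro allI impI)
      fix i assume i: "\<bar>i\<bar> \<le> int (K + r)"
      have "agree r (\<phi> x) (N + i) (\<phi> y) (- M + i)"
        unfolding agree_def
      proof (intro allI impI)
        fix j assume "\<bar>j\<bar> \<le> int r"
        with i have "\<bar>i + j\<bar> \<le> int (K + 2 * r)" by simp
        then have "\<phi> x (N + (i + j)) = \<phi> y (- M + (i + j))"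
          using ag unfolding agree_def by blast
        then show "\<phi> x (N + i + j) = \<phi> y (- M + i + j)"
          by (simp only: add.assoc)
      qed
      then have "\<psi> (\<phi> x) (N + i) = \<psi> (\<phi> y) (- M + i)"
        using code2 fwd x y unfolding block_code_def by blast
      then show "x (N + i) = y (- M + i)" using inv1 x y by simp
    qed
    have z: "glue x N y M \<in> X"
      by (rule K) (use N M ag' in \<open>auto simp: agree_def\<close>)
    have "\<phi> (glue x N y M) i = glue (\<phi> x) N (\<phi> y) M i" for i
    proof (cases "i < 0")
      case True
      have "agree r (glue x N y M) i x (i + N)"
        unfolding agree_def
      proof (intro allI impI)
        fix j assume j: "\<bar>j\<bar> \<le> int r"
        show "glue x N y M (i + j) = x (i + N + j)"
        proof (cases "i + j < 0")
          case False
          then have "\<bar>i + j\<bar> \<le> int (K + r)" using True j by simp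
          then have "x (N + (i + j)) = y (- M + (i + j))" using ag' unfolding agree_def by blast
          then show ?thesis using False by (simp add: glue_def algebra_simps)
        qed (simp add: glue_def algebra_simps)
      qed
      from codeD[OF z x this] True show ?thesis by (simp add: glue_def)
    next
      case False
      have "agree r (glue x N y M) i y (i - M)"
        unfolding agree_def
      proof (intro allI impI)
        fix j assume j: "\<bar>j\<bar> \<le> int r"
        show "glue x N y M (i + j) = y (i - M + j)"
        proof (cases "i + j < 0")
          case True
          then have "\<bar>i + j\<bar> \<le> int (K + r)" using False j by simp
          then have "x (N + (i + j)) = y (- M + (i + j))" using ag' unfolding agree_def by blast
          then show ?thesis using True by (simp add: glue_def algebra_simps)
        qed (simp add: glue_def algebra_simps)
      qed
      from codeD[OF z y this] False show ?thesis by (simp add: glue_def)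
    qed
    then have "\<phi> (glue x N y M) = glue (\<phi> x) N (\<phi> y) M" ..
    then show ?thesis using fwd[OF z] by simp
  qed
  then show ?thesis unfolding composable_def by blast
qed

end

context shift_conj
begin

interpretation S: shift_conj Y X \<psi> \<phi> r by (rule swap)

lemma left_asymp_iff: "p \<in> X \<Longrightarrow> x \<in> X \<Longrightarrow> left_asymp (\<phi> p) (\<phi> x) \<longleftrightarrow> left_asymp p x"
  using left_asymp_fwd S.left_asymp_fwd fwd inv1 by metis

lemma right_asymp_iff: "p \<in> X \<Longrightarrow> x \<in> X \<Longrightarrow> right_asymp (\<phi> p) (\<phi> x) \<longleftrightarrow> right_asymp p x"
  using right_asymp_fwd S.right_asymp_fwd fwd inv1 by metis

lemma shift2_iff: "p \<in> X \<Longrightarrow> shift (shift (\<phi> p)) = \<phi> p \<longleftrightarrow> shift (shift p) = p"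
  using shift2_fwd S.shift2_fwd fwd inv1 by metis

lemma shift_iff: "p \<in> X \<Longrightarrow> shift (\<phi> p) = \<phi> p \<longleftrightarrow> shift p = p"
  using shift_fwd S.shift_fwd fwd inv1 by metis

lemma composable_iff: "x \<in> X \<Longrightarrow> y \<in> X \<Longrightarrow> composable Y (\<phi> x) (\<phi> y) \<longleftrightarrow> composable X x y"
  using composable_fwd S.composable_fwd fwd inv1 by metis

lemma Y_ball: "(\<forall>y\<in>Y. P y) \<longleftrightarrow> (\<forall>x\<in>X. P (\<phi> x))" and Y_bex: "(\<exists>y\<in>Y. P y) \<longleftrightarrow> (\<exists>x\<in>X. P (\<phi> x))"
  using image_X by blast+

lemma image_Collect: "(\<And>x. x \<in> A \<Longrightarrow> Q (f x) \<longleftrightarrow> P x) \<Longrightarrow> {y \<in> f ` A. Q y} = f ` {x \<in> A. P x}"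
  by blast

lemma image_Collect_X:
  assumes "\<And>x. x \<in> X \<Longrightarrow> Q (\<phi> x) \<longleftrightarrow> P x"
  shows "{y \<in> Y. Q y} = \<phi> ` {x \<in> X. P x}"
  using assms image_X by blast

lemma neut_image: "neut Y = \<phi> ` neut X"
  unfolding neut_def
  by (rule image_Collect_X) (simp add: shift2_iff Y_bex left_asymp_iff right_asymp_iff composable_iff cong: bex_cong conj_cong)

lemma left_free_iff: "p \<in> X \<Longrightarrow> x \<in> X \<Longrightarrow> left_free Y (\<phi> p) (\<phi> x) \<longleftrightarrow> left_free X p x"
  unfolding left_free_def by (simp add: Y_ball right_asymp_iff composable_iff cong: ball_cong)

lemma futures_image: "q \<in> X \<Longrightarrow> futures Y (\<phi> q) = \<phi> ` futures X q"
  unfolding futures_def by (rule image_Collect_X) (simp add: left_asymp_iff)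

lemma nbhd_image: "q \<in> X \<Longrightarrow> x \<in> X \<Longrightarrow> nbhd Y (\<phi> q) (\<phi> x) = \<phi> ` nbhd X q x"
  unfolding nbhd_def by (rule image_Collect_X) (simp add: left_asymp_iff composable_iff)

lemma nbhds_image:
  assumes "p \<in> X" "q \<in> X" shows "nbhds Y (\<phi> p) (\<phi> q) = (`) \<phi> ` nbhds X p q"
proof -
  have "{y \<in> Y. left_asymp (\<phi> p) y \<and> right_asymp (\<phi> q) y \<and> left_free Y (\<phi> p) y}
      = \<phi> ` {x \<in> X. left_asymp p x \<and> right_asymp q x \<and> left_free X p x}"
    by (rule image_Collect_X) (simp add: assms left_asymp_iff right_asymp_iff left_free_iff)
  then show ?thesis
    unfolding nbhds_def image_image using assms(2) by (auto simp: nbhd_image image_image intro!: image_cong)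
qed

lemma image_inj: "S \<subseteq> X \<Longrightarrow> T \<subseteq> X \<Longrightarrow> \<phi> ` S = \<phi> ` T \<longleftrightarrow> S = T"
  using inj by (metis inj_on_image_eq_iff)

lemma image_psub: "S \<subseteq> X \<Longrightarrow> T \<subseteq> X \<Longrightarrow> \<phi> ` S \<subset> \<phi> ` T \<longleftrightarrow> S \<subset> T"
  using inj_on_image_mem_iff[OF inj] by blast

lemma sub_X: "futures X q \<subseteq> X" "S \<in> nbhds X p q \<Longrightarrow> S \<subseteq> X"
  by (auto simp: futures_def nbhds_def nbhd_def)

lemma neut_sub: "p \<in> neut X \<Longrightarrow> p \<in> X" by (simp add: neut_def)

lemma eqv_iff: "p \<in> X \<Longrightarrow> q \<in> X \<Longrightarrow> eqv Y (\<phi> p) (\<phi> q) \<longleftrightarrow> eqv X p q"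
  unfolding eqv_def by (auto simp: nbhds_image futures_image image_inj sub_X image_iff)

lemma arrows_image:
  assumes "p \<in> X" "q \<in> X" shows "arrows Y (\<phi> p) (\<phi> q) = (`) \<phi> ` arrows X p q"
proof -
  have "(\<phi> ` S \<noteq> futures Y (\<phi> q) \<and> (\<forall>p'\<in>neut Y. \<forall>S'\<in>nbhds Y p' (\<phi> q). \<phi> ` S \<subset> S' \<longrightarrow> S' = futures Y (\<phi> q)))
    \<longleftrightarrow> (S \<noteq> futures X q \<and> (\<forall>p'\<in>neut X. \<forall>S'\<in>nbhds X p' q. S \<subset> S' \<longrightarrow> S' = futures X q))"
    if S: "S \<in> nbhds X p q" for S
  proof -
    have "(\<forall>p'\<in>neut Y. \<forall>S'\<in>nbhds Y p' (\<phi> q). \<phi> ` S \<subset> S' \<longrightarrow> S' = futures Y (\<phi> q))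
      \<longleftrightarrow> (\<forall>p'\<in>neut X. \<forall>S'\<in>(`) \<phi> ` nbhds X p' q. \<phi> ` S \<subset> S' \<longrightarrow> S' = \<phi> ` futures X q)"
      using assms(2) by (simp only: neut_image futures_image nbhds_image neut_sub ball_simps cong: ball_cong)
    also have "\<dots> \<longleftrightarrow> (\<forall>p'\<in>neut X. \<forall>S'\<in>nbhds X p' q. S \<subset> S' \<longrightarrow> S' = futures X q)"
    proof -
      have "(\<phi> ` S \<subset> \<phi> ` S' \<longrightarrow> \<phi> ` S' = \<phi> ` futures X q) \<longleftrightarrow> (S \<subset> S' \<longrightarrow> S' = futures X q)"
        if "S' \<in> nbhds X p' q" for p' S'
        using image_psub[OF sub_X(2)[OF S] sub_X(2)[OF that]] image_inj[OF sub_X(2)[OF that] sub_X(1)] by simp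
      then show ?thesis by (simp only: ball_simps cong: ball_cong)
    qed
    finally show ?thesis
      using image_inj[OF sub_X(2)[OF S] sub_X(1)] assms(2) by (simp only: futures_image)
  qed
  then show ?thesis
    unfolding arrows_def nbhds_image[OF assms] by (rule image_Collect)
qed

lemma card_arrows:
  assumes "p \<in> X" "q \<in> X" shows "card (arrows Y (\<phi> p) (\<phi> q)) = card (arrows X p q)"
  unfolding arrows_image[OF assms]
proof (rule card_image, rule inj_onI)
  fix S T assume "S \<in> arrows X p q" "T \<in> arrows X p q" and eq: "\<phi> ` S = \<phi> ` T"
  then have "S \<subseteq> X" "T \<subseteq> X" unfolding arrows_def by (blast dest: sub_X(2))+
  then show "S = T" using eq by (simp add: image_inj)
qed

lemma card_eqv:
  assumes "p \<in> X" shows "card {q \<in> neut Y. eqv Y q (\<phi> p)} = card {q \<in> neut X. eqv X q p}"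
proof -
  have "{q \<in> neut Y. eqv Y q (\<phi> p)} = \<phi> ` {q \<in> neut X. eqv X q p}"
    using assms neut_sub by (auto simp: neut_image eqv_iff)
  moreover have "inj_on \<phi> {q \<in> neut X. eqv X q p}"
    using inj neut_sub by (auto intro: inj_on_subset)
  ultimately show ?thesis by (simp add: card_image)
qed

lemma card_fixed: "card {y \<in> Y. shift y = y} = card {x \<in> X. shift x = x}"
proof -
  have "{y \<in> Y. shift y = y} = \<phi> ` {x \<in> X. shift x = x}"
    by (rule image_Collect_X) (simp add: shift_iff)
  moreover have "inj_on \<phi> {x \<in> X. shift x = x}"
    using inj by (auto intro: inj_on_subset)
  ultimately show ?thesis by (simp add: card_image)
qed

lemma card_period2:
  "card {y \<in> Y. shift (shift y) = y \<and> y \<notin> neut Y} = card {x \<in> X. shift (shift x) = x \<and> x \<notin> neut X}"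
proof -
  have "x \<in> X \<Longrightarrow> \<phi> x \<in> neut Y \<longleftrightarrow> x \<in> neut X" for x
    unfolding neut_image by (metis image_iff inv1 neut_sub)
  then have "{y \<in> Y. shift (shift y) = y \<and> y \<notin> neut Y} = \<phi> ` {x \<in> X. shift (shift x) = x \<and> x \<notin> neut X}"
    by (intro image_Collect_X) (simp add: shift2_iff)
  moreover have "inj_on \<phi> {x \<in> X. shift (shift x) = x \<and> x \<notin> neut X}"
    using inj by (auto intro: inj_on_subset)
  ultimately show ?thesis by (simp add: card_image)
qed

end

lemma topologically_conjugate_imp_shift_conj:
  assumes "topologically_conjugate X Y" "shift_invariant X" "shift_invariant Y"
    "compact_space (shift_topology X)" "compact_space (shift_topology Y)"
  obtains \<phi> \<psi> r where "shift_conj X Y \<phi> \<psi> r"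
proof -
  obtain \<phi> where hom: "homeomorphic_map (shift_topology X) (shift_topology Y) \<phi>"
    and comm: "\<forall>x\<in>X. \<phi> (shift x) = shift (\<phi> x)"
    using assms(1) by (auto simp: topologically_conjugate_def)
  obtain \<psi> where maps: "homeomorphic_maps (shift_topology X) (shift_topology Y) \<phi> \<psi>"
    using hom by (auto simp: homeomorphic_map_maps)
  have c1: "continuous_map (shift_topology X) (shift_topology Y) \<phi>"
    and c2: "continuous_map (shift_topology Y) (shift_topology X) \<psi>"
    and i1: "\<And>x. x \<in> X \<Longrightarrow> \<psi> (\<phi> x) = x" and i2: "\<And>y. y \<in> Y \<Longrightarrow> \<phi> (\<psi> y) = y"
    using maps by (auto simp: homeomorphic_maps_def)
  have m1: "\<And>x. x \<in> X \<Longrightarrow> \<phi> x \<in> Y" and m2: "\<And>y. y \<in> Y \<Longrightarrow> \<psi> y \<in> X"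
    using continuous_map_funspace[OF c1] continuous_map_funspace[OF c2] by auto
  have sh: "shift x \<in> X" if "x \<in> X" for x
    using assms(2) that shift_shift_by[of 0 x] by (auto simp: shift_invariant_def shift_by_def)
  have comm2: "\<forall>y\<in>Y. \<psi> (shift y) = shift (\<psi> y)"
    using comm i1 i2 m2 sh by metis
  obtain r s where "block_code X \<phi> r" "block_code Y \<psi> s"
    using continuous_imp_block_code[OF assms(4,2) c1 comm] continuous_imp_block_code[OF assms(5,3) c2 comm2]
    by blast
  then have "block_code X \<phi> (max r s)" "block_code Y \<psi> (max r s)"
    by (auto intro: block_code_mono)
  then have "shift_conj X Y \<phi> \<psi> (max r s)"
    by unfold_locales (use m1 m2 i1 i2 in auto)
  then show thesis by (rule that)
qed

section \<open>The graph inverse semigroup as a stack machine\<close>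

text \<open>
  States are a vertex and a stack of open brackets. An edge that is the only one into its target is
  not recorded on the stack, since the vertex alone determines its closing bracket; the stack is
  thus one for the contracted graph.
\<close>

fun gact :: "('v, 'e) pre_digraph \<Rightarrow> ('v, 'e) gis_gen \<Rightarrow> 'v \<times> 'e list \<Rightarrow> ('v \<times> 'e list) option" where
  "gact G Zero s = None"
| "gact G (Unit v) s = (if fst s = v then Some s else None)"
| "gact G (Minus e) s = (if e \<in> arcs G \<and> fst s = tail G e
     then Some (head G e, if e \<in> F_edges G then snd s else e # snd s) else None)"
| "gact G (Plus e) s = (if e \<in> arcs G \<and> fst s = head G e
     then (if e \<in> F_edges G then Some (tail G e, snd s)
       else (case snd s of [] \<Rightarrow> None | e' # st \<Rightarrow> if e' = e then Some (tail G e, st) else None))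
     else None)"

fun run :: "('v, 'e) pre_digraph \<Rightarrow> ('v, 'e) gis_gen list \<Rightarrow> 'v \<times> 'e list \<Rightarrow> ('v \<times> 'e list) option" where
  "run G [] s = Some s"
| "run G (a # w) s = Option.bind (gact G a s) (run G w)"

definition runnable :: "('v, 'e) pre_digraph \<Rightarrow> ('v, 'e) gis_gen list \<Rightarrow> bool" where
  "runnable G w \<longleftrightarrow> (\<exists>s. run G w s \<noteq> None)"

lemma run_append: "run G (u @ w) s = Option.bind (run G u s) (run G w)"
  by (induction u arbitrary: s) (auto simp: bind_eq_None_conv split: bind_split)

lemma F_edges_unique: "e \<in> F_edges G \<Longrightarrow> g \<in> arcs G \<Longrightarrow> head G g = head G e \<Longrightarrow> g = e"
  by (auto simp: F_edges_def in_arcs_def)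

text \<open>The delicate relation is that \<open>Minus f\<close> followed by a different
  \<open>Plus g\<close> is zero, as an unrecorded edge cannot be compared with the top of the stack.
  If one of the two edges is unrecorded, it is the only one into its target, so the targets differ
  and the machine halts.\<close>

lemma gis_rel_run: "gis_rel G x y \<Longrightarrow> run G x = run G y"
proof (induction rule: gis_rel.induct)
  case (zero_right x)
  then show ?case by (auto simp: fun_eq_iff split: bind_split)
next
  case (minus_plus_diff f g)
  then show ?case
    by (auto simp: fun_eq_iff split: bind_split list.split dest: F_edges_unique)
qed (auto simp: fun_eq_iff split: bind_split list.split)

lemma gis_cong_run: "gis_cong G x y \<Longrightarrow> run G x = run G y"
  by (induction rule: gis_cong.induct) (auto intro!: ext simp: gis_rel_run run_append)

section \<open>Normal forms in the graph inverse semigroup\<close>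

context wf_digraph
begin

text \<open>The congruence is generated with nonempty contexts only; this version also admits empty
  ones.\<close>

lemma cong_append:
  assumes "gis_cong G x y" "set u \<subseteq> gis_gens G" "set w \<subseteq> gis_gens G"
  shows "gis_cong G (u @ x @ w) (u @ y @ w)"
proof -
  have "gis_cong G (x @ w) (y @ w)"
    using assms(1,3) by (cases "w = []") (auto simp: gis_words_def in_lists_conv_set subset_iff intro: gis_cong.right)
  then show ?thesis
    using assms(2) by (cases "u = []") (auto simp: gis_words_def in_lists_conv_set subset_iff intro: gis_cong.left)
qed

lemma cong_rel:
  assumes "gis_rel G x y" "set u \<subseteq> gis_gens G" "set w \<subseteq> gis_gens G"
  shows "gis_cong G (u @ x @ w) (u @ y @ w)"
  using cong_append[OF gis_cong.base[OF assms(1)]] assms(2,3) by blast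

lemma cong_zero_absorb:
  assumes "set u \<subseteq> gis_gens G" "set w \<subseteq> gis_gens G"
  shows "gis_cong G (u @ [Zero] @ w) [Zero]"
proof -
  have z: "Zero \<in> gis_gens G" by (simp add: gis_gens_def)
  have r: "gis_cong G ([Zero] @ w) [Zero]"
    using assms(2)
  proof (induction w)
    case Nil
    then show ?case using z by (auto intro!: gis_cong.refl simp: gis_words_def)
  next
    case (Cons a w)
    have "gis_cong G ([] @ [Zero, a] @ w) ([] @ [Zero] @ w)"
      by (rule cong_rel) (use Cons.prems in \<open>auto intro: gis_rel.zero_left\<close>)
    with Cons show ?case by (auto intro: gis_cong.trans)
  qed
  have "gis_cong G (u @ [Zero]) [Zero]"
    using assms(1)
  proof (induction u rule: rev_induct)
    case Nil
    then show ?case using z by (auto intro!: gis_cong.refl simp: gis_words_def)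
  next
    case (snoc a u)
    have "gis_cong G (u @ [a, Zero] @ []) (u @ [Zero] @ [])"
      by (rule cong_rel) (use snoc.prems in \<open>auto intro: gis_rel.zero_right\<close>)
    with snoc show ?case by (auto intro: gis_cong.trans)
  qed
  moreover have "gis_cong G (u @ ([Zero] @ w) @ []) (u @ [Zero] @ [])"
    by (rule cong_append[OF r]) (use assms(1) in auto)
  ultimately show ?thesis by (auto intro: gis_cong.trans)
qed

text \<open>The classical normal form of a nonzero element: close brackets backwards along
  \<open>p\<close> down to \<open>v\<close>, then open brackets along \<open>q\<close>. Both walks
  start at \<open>v\<close>; the unit in the middle also covers the case that both are
  empty.\<close>

definition nf :: "'a \<Rightarrow> 'b list \<Rightarrow> 'b list \<Rightarrow> ('a, 'b) gis_gen list" where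
  "nf v p q = map Plus (rev p) @ Unit v # map Minus q"

lemma nf_gens: "awalk v p u \<Longrightarrow> awalk v q u' \<Longrightarrow> set (nf v p q) \<subseteq> gis_gens G"
  by (auto simp: nf_def gis_gens_def awalk_def)

lemma nf_unit:
  assumes "awalk v p u" "awalk v q u'"
  shows "gis_cong G (nf v p q @ [Unit u']) (nf v p q)"
proof (cases q rule: rev_cases)
  case Nil
  then have "u' = v" using assms(2) by auto
  have "gis_cong G (map Plus (rev p) @ [Unit v, Unit v] @ []) (map Plus (rev p) @ [Unit v] @ [])"
    by (rule cong_rel) (use assms in \<open>auto simp: gis_gens_def awalk_def intro: gis_rel.unit_idem\<close>)
  then show ?thesis using Nil \<open>u' = v\<close> by (simp add: nf_def)
next
  case (snoc q' b)
  then have b: "b \<in> arcs G" "head G b = u'" using assms(2) by (auto simp: awalk_simps)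
  have "gis_cong G (nf v p q' @ [Minus b, Unit (head G b)] @ []) (nf v p q' @ [Minus b] @ [])"
    by (rule cong_rel) (use assms b snoc in \<open>auto simp: nf_def gis_gens_def awalk_def intro: gis_rel.minus_right\<close>)
  then show ?thesis using snoc b by (simp add: nf_def)
qed

text \<open>The assumption on \<open>a\<close> says that it starts at \<open>x\<close>. Inserting
  the unit at the end of the normal form and the unit at \<open>x\<close> before \<open>a\<close>
  produces two orthogonal units.\<close>

lemma nf_mismatch:
  assumes w: "awalk v p u" "awalk v q u'" and x: "x \<in> verts G" "x \<noteq> u'"
    and a: "gis_rel G [Unit x, a] [a]" "a \<in> gis_gens G"
  shows "gis_cong G (nf v p q @ [a]) [Zero]"
proof -
  have S: "set (nf v p q) \<subseteq> gis_gens G" using nf_gens[OF w] .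
  have u': "u' \<in> verts G" using w(2) by auto
  have "gis_cong G ([] @ nf v p q @ [a]) ([] @ (nf v p q @ [Unit u']) @ [a])"
    using cong_append[OF gis_cong.sym[OF nf_unit[OF w]], of "[]" "[a]"] a by simp
  moreover have "gis_cong G ((nf v p q @ [Unit u']) @ [a] @ []) ((nf v p q @ [Unit u']) @ [Unit x, a] @ [])"
    by (rule gis_cong.sym, rule cong_rel) (use a S u' in \<open>auto simp: gis_gens_def\<close>)
  moreover have "gis_cong G (nf v p q @ [Unit u', Unit x] @ [a]) (nf v p q @ [Zero] @ [a])"
    by (rule cong_rel) (use a S u' x in \<open>auto intro: gis_rel.unit_orth\<close>)
  moreover have "gis_cong G (nf v p q @ [Zero] @ [a]) [Zero]"
    by (rule cong_zero_absorb) (use a S in auto)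
  ultimately show ?thesis by (auto intro: gis_cong.trans)
qed

text \<open>Units are absorbed and an opening bracket prolongs \<open>q\<close>. A closing bracket
  cancels against the last edge of \<open>q\<close> or gives zero; if \<open>q\<close> is empty, it
  prolongs \<open>p\<close>.\<close>

lemma nf_snoc:
  assumes w: "awalk v p u" "awalk v q u'" and a: "a \<in> gis_gens G"
  shows "gis_cong G (nf v p q @ [a]) [Zero] \<or>
    (\<exists>v' p' q' u u'. awalk v' p' u \<and> awalk v' q' u' \<and> gis_cong G (nf v p q @ [a]) (nf v' p' q'))"
proof (rule disj_imp[THEN iffD2], rule impI)
  have S: "set (nf v p q) \<subseteq> gis_gens G" using nf_gens[OF w] .
  have u': "u' \<in> verts G" using w(2) by auto
  assume nz: "\<not> gis_cong G (nf v p q @ [a]) [Zero]"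
  have Sa: "nf v p q @ [a] \<in> gis_words G"
    using S a by (auto simp: gis_words_def in_lists_conv_set)
  show "\<exists>v' p' q' u u'. awalk v' p' u \<and> awalk v' q' u' \<and> gis_cong G (nf v p q @ [a]) (nf v' p' q')"
  proof (cases a)
    case Zero
    then show ?thesis using nz cong_zero_absorb[OF S, of "[]"] by simp
  next
    case (Unit x)
    then have x: "x \<in> verts G" using a by (auto simp: gis_gens_def)
    then have "x = u'"
      using nz nf_mismatch[OF w x, of a] a unit_idem[OF x] Unit by blast
    then show ?thesis using nf_unit[OF w] w Unit by blast
  next
    case (Minus e)
    then have e: "e \<in> arcs G" using a by (auto simp: gis_gens_def)
    then have "tail G e = u'"
      using nz nf_mismatch[OF w, of "tail G e" a] a minus_left[OF e] Minus by auto
    then have "awalk v (q @ [e]) (head G e)"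
      using w(2) e by (auto simp: awalk_simps)
    moreover have "nf v p q @ [a] = nf v p (q @ [e])" by (simp add: nf_def Minus)
    ultimately show ?thesis using w(1) gis_cong.refl[OF Sa] by metis
  next
    case (Plus e)
    then have e: "e \<in> arcs G" using a by (auto simp: gis_gens_def)
    then have hd: "head G e = u'"
      using nz nf_mismatch[OF w, of "head G e" a] a plus_left[OF e] Plus by auto
    show ?thesis
    proof (cases q rule: rev_cases)
      case Nil
      \<comment> \<open>With nothing left to cancel, \<open>e\<close> becomes the first edge of the
        closing half and the centre moves to \<open>tail G e\<close>.\<close>
      then have v: "v = head G e" using w(2) hd by auto
      have P: "set (map Plus (rev p)) \<subseteq> gis_gens G"
        using w(1) by (auto simp: awalk_def gis_gens_def)
      have "gis_cong G (map Plus (rev p) @ [Unit v, Plus e] @ []) (map Plus (rev p) @ [Plus e] @ [])"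
        by (rule cong_rel) (use P v e in \<open>auto intro: gis_rel.plus_left\<close>)
      moreover have "gis_cong G (map Plus (rev p) @ [Plus e] @ []) (map Plus (rev p) @ [Plus e, Unit (tail G e)] @ [])"
        by (rule gis_cong.sym, rule cong_rel) (use P v e in \<open>auto intro: gis_rel.plus_right\<close>)
      ultimately have "gis_cong G (nf v p q @ [a]) (nf (tail G e) (e # p) [])"
        using Nil Plus by (auto simp: nf_def intro: gis_cong.trans)
      moreover have "awalk (tail G e) (e # p) u" "awalk (tail G e) [] (tail G e)"
        using w(1) v e by (auto simp: awalk_simps)
      ultimately show ?thesis by blast
    next
      case (snoc q' b)
      then have b: "b \<in> arcs G" "head G b = u'" and q': "awalk v q' (tail G b)"
        using w(2) by (auto simp: awalk_simps)
      have S': "set (nf v p q') \<subseteq> gis_gens G" using nf_gens[OF w(1) q'] .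
      have eq: "nf v p q @ [a] = nf v p q' @ [Minus b, Plus e] @ []"
        by (simp add: nf_def snoc Plus)
      show ?thesis
      proof (cases "b = e")
        case True
        have "gis_cong G (nf v p q' @ [Minus b, Plus e] @ []) (nf v p q' @ [Unit (tail G b)] @ [])"
          by (rule cong_rel) (use S' b True in \<open>auto intro: gis_rel.minus_plus_same\<close>)
        then have "gis_cong G (nf v p q @ [a]) (nf v p q')"
          unfolding eq using nf_unit[OF w(1) q'] by (auto intro: gis_cong.trans)
        then show ?thesis using w(1) q' by blast
      next
        case False
        have "gis_cong G (nf v p q' @ [Minus b, Plus e] @ []) (nf v p q' @ [Zero] @ [])"
          by (rule cong_rel) (use S' b e False in \<open>auto intro: gis_rel.minus_plus_diff\<close>)
        then have "gis_cong G (nf v p q @ [a]) [Zero]"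
          unfolding eq using cong_zero_absorb[OF S', of "[]"] by (auto intro: gis_cong.trans)
        then show ?thesis using nz by simp
      qed
    qed
  qed
qed

lemma nf_exists:
  assumes "w \<in> gis_words G"
  shows "gis_cong G w [Zero] \<or> (\<exists>v p q u u'. awalk v p u \<and> awalk v q u' \<and> gis_cong G w (nf v p q))"
  using assms
proof (induction w rule: rev_induct)
  case Nil
  then show ?case by (simp add: gis_words_def)
next
  case (snoc a w)
  then have a: "a \<in> gis_gens G" by (auto simp: gis_words_def)
  show ?case
  proof (cases "w = []")
    case True
    show ?thesis
    proof (cases a)
      case Zero
      then show ?thesis using True a by (auto intro!: gis_cong.refl simp: gis_words_def)
    next
      case (Unit v)
      then have "v \<in> verts G" using a by (auto simp: gis_gens_def)
      then have "awalk v [] v" "gis_cong G (w @ [a]) (nf v [] [])"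
        using True a Unit by (auto simp: awalk_simps nf_def gis_words_def intro!: gis_cong.refl)
      then show ?thesis by blast
    next
      case (Minus e)
      then have e: "e \<in> arcs G" using a by (auto simp: gis_gens_def)
      then have "awalk (tail G e) [] (tail G e)" "awalk (tail G e) [e] (head G e)"
        "gis_cong G (w @ [a]) (nf (tail G e) [] [e])"
        using True Minus by (auto simp: awalk_simps nf_def intro!: gis_cong.sym[OF gis_cong.base] gis_rel.minus_left)
      then show ?thesis by blast
    next
      case (Plus e)
      then have e: "e \<in> arcs G" using a by (auto simp: gis_gens_def)
      then have "awalk (tail G e) [] (tail G e)" "awalk (tail G e) [e] (head G e)"
        "gis_cong G (w @ [a]) (nf (tail G e) [e] [])"
        using True Plus by (auto simp: awalk_simps nf_def intro!: gis_cong.sym[OF gis_cong.base] gis_rel.plus_right)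
      then show ?thesis by blast
    qed
  next
    case False
    then have "w \<in> gis_words G" using snoc.prems by (auto simp: gis_words_def)
    then consider "gis_cong G w [Zero]"
      | v p q u u' where "awalk v p u" "awalk v q u'" "gis_cong G w (nf v p q)"
      using snoc.IH by blast
    then show ?thesis
    proof cases
      case 1
      then have "gis_cong G ([] @ w @ [a]) ([] @ [Zero] @ [a])"
        by (rule cong_append) (use a in auto)
      then show ?thesis using cong_zero_absorb[of "[]" "[a]"] a by (auto intro: gis_cong.trans)
    next
      case 2
      then have "gis_cong G ([] @ w @ [a]) ([] @ nf v p q @ [a])"
        by (intro cong_append) (use a in auto)
      then show ?thesis
        using nf_snoc[OF 2(1,2) a] unfolding append_Nil by (meson gis_cong.trans)
    qed
  qed
qed

lemma run_Plus_walk: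
  "awalk v p u \<Longrightarrow> run G (map Plus (rev p)) (u, rev (filter (\<lambda>e. e \<notin> F_edges G) p) @ t) = Some (v, t)"
  by (induction p arbitrary: v t) (auto simp: run_append awalk_simps)

lemma run_Minus_walk:
  "awalk v q u \<Longrightarrow> run G (map Minus q) (v, t) = Some (u, rev (filter (\<lambda>e. e \<notin> F_edges G) q) @ t)"
  by (induction q arbitrary: v t) (auto simp: awalk_simps)

text \<open>The start state carries exactly the recorded edges of \<open>p\<close>, which the
  closing half pops; the opening half needs nothing from the stack.\<close>

lemma runnable_nf: "awalk v p u \<Longrightarrow> awalk v q u' \<Longrightarrow> runnable G (nf v p q)"
  unfolding runnable_def nf_def
  by (intro exI[of _ "(u, rev (filter (\<lambda>e. e \<notin> F_edges G) p))"])
    (use run_Plus_walk[of v p u "[]"] run_Minus_walk[of v q u'] in \<open>simp add: run_append\<close>)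

text \<open>Congruent words act alike and \<open>Zero\<close> acts nowhere, so a runnable word is
  not zero. Conversely, a nonzero word is congruent to a normal form, and normal forms run.\<close>

lemma admissible_iff_runnable:
  assumes "w \<in> gis_words G" shows "md_admissible G w \<longleftrightarrow> runnable G w"
proof -
  have z: "[Zero] \<in> gis_words G" by (auto simp: gis_words_def gis_gens_def)
  have "gis_class G w = gis_class G [Zero] \<longleftrightarrow> gis_cong G w [Zero]"
    unfolding gis_class_def using z by (auto intro: gis_cong.trans gis_cong.sym gis_cong.refl)
  moreover have "gis_cong G w [Zero] \<longleftrightarrow> \<not> runnable G w"
  proof
    assume "gis_cong G w [Zero]"
    then show "\<not> runnable G w" by (simp add: runnable_def gis_cong_run)
  next
    assume nr: "\<not> runnable G w"
    show "gis_cong G w [Zero]"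
    proof (rule ccontr)
      assume "\<not> gis_cong G w [Zero]"
      then obtain v p q u u' where "awalk v p u" "awalk v q u'" "gis_cong G w (nf v p q)"
        using nf_exists[OF assms] by blast
      then show False using nr runnable_nf gis_cong_run unfolding runnable_def by metis
    qed
  qed
  ultimately show ?thesis
    by (simp add: md_admissible_def graph_inverse_semigroup_def)
qed

end

section \<open>Finite windows of two-sided sequences\<close>

fun win :: "(int \<Rightarrow> 'a) \<Rightarrow> int \<Rightarrow> nat \<Rightarrow> 'a list" where
  "win x i 0 = []"
| "win x i (Suc n) = x i # win x (i + 1) n"

lemma win_add: "win x i (m + n) = win x i m @ win x (i + int m) n"
  by (induction m arbitrary: i) (auto simp: add.assoc)

lemma win_cong: "(\<And>j. i \<le> j \<Longrightarrow> j < i + int n \<Longrightarrow> x j = y (j + k)) \<Longrightarrow> win x i n = win y (i + k) n"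
proof (induction n arbitrary: i)
  case (Suc n)
  have "win x (i + 1) n = win y (i + 1 + k) n"
    by (rule Suc.IH) (use Suc.prems in auto)
  moreover have "i + 1 + k = i + k + 1" by simp
  ultimately show ?case using Suc.prems[of i] by simp
qed simp

lemma length_win [simp]: "length (win x i n) = n"
  by (induction n arbitrary: i) auto

lemma set_win: "set (win x i n) = x ` {i..<i + int n}"
proof (induction n arbitrary: i)
  case (Suc n)
  have "{i..<i + int (Suc n)} = insert i {i + 1..<i + 1 + int n}" by auto
  then show ?case using Suc by simp
qed simp

lemma map_upto_win: "map x [i..i + int n - 1] = win x i n"
proof (induction n arbitrary: i)
  case (Suc n)
  have "[i..i + int (Suc n) - 1] = i # [i + 1..i + 1 + int n - 1]"
    by (subst upto.simps) (simp add: algebra_simps)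
  then show ?case using Suc[of "i + 1"] by (simp add: algebra_simps)
qed simp

lemma runnable_factor: "runnable G (u @ w @ z) \<Longrightarrow> runnable G w"
  unfolding runnable_def run_append
  by (metis (no_types, lifting) bind_eq_None_conv option.collapse)

lemma runnable_win_mono:
  assumes "runnable G (win x i n)" "i \<le> j" "j + int m \<le> i + int n"
  shows "runnable G (win x j m)"
proof -
  define a where "a = nat (j - i)"
  define b where "b = nat (i + int n - (j + int m))"
  have "n = a + (m + b)" "j = i + int a" using assms by (auto simp: a_def b_def)
  then have "win x i n = win x i a @ win x j m @ win x (j + int m) b"
    by (simp only: win_add)
  then show ?thesis using assms(1) runnable_factor by metis
qed

lemma (in wf_digraph) MD_iff:
  "x \<in> MD G \<longleftrightarrow> (\<forall>i. x i \<in> md_alphabet G) \<and> (\<forall>i n. runnable G (win x i n))"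
proof (cases "\<forall>i. x i \<in> md_alphabet G")
  case True
  have w: "win x i (Suc n) \<in> gis_words G" for i n
  proof -
    have "set (win x i (Suc n)) \<subseteq> md_alphabet G" unfolding set_win using True by auto
    then show ?thesis by (auto simp: gis_words_def md_alphabet_def gis_gens_def in_lists_conv_set)
  qed
  have "(\<forall>i j. i \<le> j \<longrightarrow> md_admissible G (map x [i..j])) \<longleftrightarrow> (\<forall>i n. md_admissible G (win x i (Suc n)))"
    (is "?L \<longleftrightarrow> ?R")
  proof
    assume L: ?L
    show ?R
    proof (intro allI)
      fix i n
      have "i \<le> i + int (Suc n) - 1" by simp
      with L have "md_admissible G (map x [i..i + int (Suc n) - 1])" by blast
      then show "md_admissible G (win x i (Suc n))" by (simp only: map_upto_win)
    qed
  next
    assume R: ?R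
    show ?L
    proof (intro allI impI)
      fix i j :: int assume "i \<le> j"
      define n where "n = nat (j - i)"
      have "j = i + int (Suc n) - 1" using \<open>i \<le> j\<close> by (simp add: n_def)
      then show "md_admissible G (map x [i..j])" using R by (simp only: map_upto_win)
    qed
  qed
  also have "\<dots> \<longleftrightarrow> (\<forall>i n. runnable G (win x i (Suc n)))"
    using w by (simp only: admissible_iff_runnable)
  also have "\<dots> \<longleftrightarrow> (\<forall>i n. runnable G (win x i n))"
  proof -
    have "runnable G (win x i 0)" for i by (simp add: runnable_def)
    then show ?thesis by (metis not0_implies_Suc)
  qed
  finally show ?thesis by (simp add: MD_def True)
qed (auto simp: MD_def)

section \<open>Gluing along runs of a two-periodic point\<close>

lemma nth_win: "j < n \<Longrightarrow> win x i n ! j = x (i + int j)"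
proof (induction n arbitrary: i j)
  case (Suc n)
  then show ?case by (cases j) (simp_all add: add.assoc)
qed simp

fun flip :: "('v, 'e) gis_gen \<Rightarrow> ('v, 'e) gis_gen" where
  "flip (Minus e) = Plus e" | "flip (Plus e) = Minus e" | "flip a = a"

definition inv_word :: "('v, 'e) gis_gen list \<Rightarrow> ('v, 'e) gis_gen list" where
  "inv_word w = rev (map flip w)"

text \<open>Brackets act as partial injections, each undone by its partner: a popped edge is known
  from the letter, so no information is lost.\<close>

lemma gact_flip:
  assumes "a \<in> md_alphabet G" "gact G a s = Some s'" shows "gact G (flip a) s' = Some s"
  using assms by (cases a; cases s; cases s') (auto simp: md_alphabet_def split: if_splits list.splits)

lemma run_inv_word:
  "set w \<subseteq> md_alphabet G \<Longrightarrow> run G w s = Some s' \<Longrightarrow> run G (inv_word w) s' = Some s"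
proof (induction w arbitrary: s)
  case (Cons a w)
  then obtain s1 where "gact G a s = Some s1" "run G w s1 = Some s'"
    by (auto simp: bind_eq_Some_conv)
  then show ?case
    using Cons gact_flip[of a G s s1] by (simp add: inv_word_def run_append)
qed (simp add: inv_word_def)

lemma inv_word_alphabet: "set w \<subseteq> md_alphabet G \<Longrightarrow> set (inv_word w) \<subseteq> md_alphabet G"
  by (auto simp: inv_word_def md_alphabet_def)

lemma inv_word_append: "inv_word (u @ w) = inv_word w @ inv_word u"
  by (simp add: inv_word_def)

definition pushes :: "('v, 'e) pre_digraph \<Rightarrow> ('v, 'e) gis_gen list \<Rightarrow> 'v \<Rightarrow> 'e list \<Rightarrow> 'v \<Rightarrow> bool" where
  "pushes G w v k v' \<longleftrightarrow> (\<forall>t. run G w (v, t) = Some (v', k @ t))"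

definition pops :: "('v, 'e) pre_digraph \<Rightarrow> ('v, 'e) gis_gen list \<Rightarrow> 'v \<Rightarrow> 'e list \<Rightarrow> 'v \<Rightarrow> bool" where
  "pops G w v k v' \<longleftrightarrow> (\<forall>t. run G w (v, k @ t) = Some (v', t))"

lemma pushes_append: "pushes G u v k v' \<Longrightarrow> pushes G w v' l v'' \<Longrightarrow> pushes G (u @ w) v (l @ k) v''"
  by (simp add: pushes_def run_append)

lemma pops_inv: "set w \<subseteq> md_alphabet G \<Longrightarrow> pushes G w v k v' \<Longrightarrow> pops G (inv_word w) v' k v"
  unfolding pushes_def pops_def using run_inv_word by blast

text \<open>From a fixed vertex a word acts as "pop \<open>h\<close>, push \<open>k\<close>", and
  \<open>h\<close> is the least stack that it needs. In the induction a recorded closing bracket is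
  put in front of \<open>h\<close>; a recorded opening bracket removes the head of \<open>h\<close>
  or, if \<open>h\<close> is empty, goes to the bottom of \<open>k\<close>.\<close>

lemma run_factor:
  assumes "set w \<subseteq> md_alphabet G" "run G w (v, t) = Some (v', t')"
  shows "\<exists>h k s. t = h @ s \<and> t' = k @ s \<and> (\<forall>u. run G w (v, h @ u) = Some (v', k @ u)) \<and>
    (\<forall>u. run G w (v, u) \<noteq> None \<longrightarrow> (\<exists>u'. u = h @ u')) \<and> length h \<le> length (filter (\<lambda>a. a \<in> range Plus) w)"
  using assms
proof (induction w arbitrary: v t)
  case Nil
  then show ?case by (rule_tac exI[of _ "[]"], rule_tac exI[of _ "[]"], rule_tac exI[of _ t]) auto
next
  case (Cons a w)
  from Cons.prems obtain v1 t1 where a: "gact G a (v, t) = Some (v1, t1)" and w: "run G w (v1, t1) = Some (v', t')"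
    by (auto simp: bind_eq_Some_conv)
  from Cons.IH[OF _ w] Cons.prems(1) obtain h k s where IH: "t1 = h @ s" "t' = k @ s"
    "\<And>u. run G w (v1, h @ u) = Some (v', k @ u)" "\<And>u. run G w (v1, u) \<noteq> None \<Longrightarrow> \<exists>u'. u = h @ u'"
    "length h \<le> length (filter (\<lambda>a. a \<in> range Plus) w)"
    by auto
  consider e where "a = Minus e" | e where "a = Plus e"
    using Cons.prems(1) by (auto simp: md_alphabet_def)
  then show ?case
  proof cases
    case 1
    show ?thesis
    proof (cases "e \<in> F_edges G")
      case True
      then show ?thesis using a IH 1
        by (intro exI[of _ h] exI[of _ k] exI[of _ s]) (auto split: if_splits)
    next
      case False
      show ?thesis
      proof (cases h)
        case Nil
        then show ?thesis using a IH(1,2,5) IH(3)[of "e # u" for u] 1 False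
          by (intro exI[of _ "[]"] exI[of _ "k @ [e]"] exI[of _ t]) (auto split: if_splits)
      next
        case (Cons e' h')
        have "\<exists>u'. u = h' @ u'" if "run G (a # w) (v, u) \<noteq> None" for u
          using IH(4)[of "e # u"] that 1 False Cons a by (auto split: if_splits)
        moreover have "run G (a # w) (v, h' @ u) = Some (v', k @ u)" for u
          using IH(1) IH(3)[of u] 1 False Cons a by (auto split: if_splits)
        ultimately show ?thesis using a IH(1,2,5) 1 False Cons
          by (intro exI[of _ h'] exI[of _ k] exI[of _ s]) (auto split: if_splits)
      qed
    qed
  next
    case 2
    show ?thesis
    proof (cases "e \<in> F_edges G")
      case True
      then show ?thesis using a IH 2
        by (intro exI[of _ h] exI[of _ k] exI[of _ s]) (auto split: if_splits)
    next
      case False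
      have "\<exists>u'. u = (e # h) @ u'" if "run G (a # w) (v, u) \<noteq> None" for u
        using IH(4)[of "tl u"] that 2 False a by (auto split: if_splits list.splits)
      then show ?thesis using a IH(1,2,3,5) 2 False
        by (intro exI[of _ "e # h"] exI[of _ k] exI[of _ s]) (auto split: if_splits list.splits)
    qed
  qed
qed

lemma run_prefix: "run G (u @ w) s \<noteq> None \<Longrightarrow> run G u s \<noteq> None"
  by (cases "run G u s") (auto simp: run_append)

lemma run_win_mono: "run G (win x i n) s \<noteq> None \<Longrightarrow> m \<le> n \<Longrightarrow> run G (win x i m) s \<noteq> None"
  using win_add[of x i m "n - m"] run_prefix by (metis le_add_diff_inverse)

section \<open>Points with tails that repeat one bracket pair\<close>

definition blink :: "'e \<Rightarrow> int \<Rightarrow> ('v, 'e) gis_gen" where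
  "blink e i = (if even i then Minus e else Plus e)"

text \<open>The phase is tied to the cut: a complete pair \<open>Minus e\<close>,
  \<open>Plus e\<close> ends just before \<open>\<nu>\<close>, so the machine stands at
  \<open>tail G e\<close> there. Likewise \<open>rcut\<close> places the cut before a complete
  pair.\<close>

definition lcut :: "'e \<Rightarrow> int \<Rightarrow> (int \<Rightarrow> ('v, 'e) gis_gen) \<Rightarrow> bool" where
  "lcut e \<nu> y \<longleftrightarrow> (\<forall>i<\<nu>. y i = blink e (i - \<nu>))"

definition rcut :: "'e \<Rightarrow> int \<Rightarrow> (int \<Rightarrow> ('v, 'e) gis_gen) \<Rightarrow> bool" where
  "rcut e \<kappa> x \<longleftrightarrow> (\<forall>i\<ge>\<kappa>. x i = blink e (i - \<kappa>))"

lemma left_asymp_blink_iff: "left_asymp (blink e) y \<longleftrightarrow> (\<exists>\<nu>. lcut e \<nu> y)"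
proof
  assume "left_asymp (blink e) y"
  then obtain n K where nK: "\<And>i. i \<le> K \<Longrightarrow> y i = blink e (i + n)" by (auto simp: left_asymp_def)
  \<comment> \<open>The cut moves back by one position if otherwise it would split a pair.\<close>
  define \<nu> where "\<nu> = (if even (K + n) then K else K - 1)"
  have "lcut e \<nu> y"
    unfolding lcut_def using nK by (auto simp: \<nu>_def blink_def split: if_splits)
  then show "\<exists>\<nu>. lcut e \<nu> y" ..
next
  assume "\<exists>\<nu>. lcut e \<nu> y"
  then obtain \<nu> where "lcut e \<nu> y" ..
  then show "left_asymp (blink e) y" unfolding left_asymp_def lcut_def
    by (intro exI[of _ "- \<nu>"] exI[of _ "\<nu> - 1"]) auto
qed

lemma right_asymp_blink_iff: "right_asymp (blink e) y \<longleftrightarrow> (\<exists>\<kappa>. rcut e \<kappa> y)"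
proof
  assume "right_asymp (blink e) y"
  then obtain n K where nK: "\<And>i. i \<ge> K \<Longrightarrow> y i = blink e (i + n)" by (auto simp: right_asymp_def)
  define \<kappa> where "\<kappa> = (if even (K + n) then K else K + 1)"
  have "rcut e \<kappa> y"
    unfolding rcut_def using nK by (auto simp: \<kappa>_def blink_def split: if_splits)
  then show "\<exists>\<kappa>. rcut e \<kappa> y" ..
next
  assume "\<exists>\<kappa>. rcut e \<kappa> y"
  then obtain \<kappa> where "rcut e \<kappa> y" ..
  then show "right_asymp (blink e) y" unfolding right_asymp_def rcut_def
    by (intro exI[of _ "- \<kappa>"] exI[of _ \<kappa>]) auto
qed

lemma rcut_add: "rcut e \<kappa> x \<Longrightarrow> rcut e (\<kappa> + 2 * int j) x"
  by (auto simp: rcut_def blink_def)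

lemma rcut_above: "rcut e \<kappa> x \<Longrightarrow> \<exists>\<kappa>'\<ge>\<nu>. rcut e \<kappa>' x"
proof -
  assume "rcut e \<kappa> x"
  then have "rcut e (\<kappa> + 2 * int (nat (\<nu> - \<kappa>))) x" by (rule rcut_add)
  moreover have "\<nu> \<le> \<kappa> + 2 * int (nat (\<nu> - \<kappa>))" by simp
  ultimately show ?thesis by blast
qed

lemma win_lcut: "lcut e \<nu> x \<Longrightarrow> win x (\<nu> - 2 * int j) (2 * j) = win (blink e) 0 (2 * j)"
  using win_cong[of "\<nu> - 2 * int j" "2 * j" x "blink e" "2 * int j - \<nu>"] by (auto simp: lcut_def blink_def)

lemma win_rcut: "rcut e \<kappa> x \<Longrightarrow> win x \<kappa> n = win (blink e) 0 n"
  using win_cong[of \<kappa> n x "blink e" "- \<kappa>"] by (auto simp: rcut_def)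

lemma win_blink_add: "win (blink e) 0 (2 * n + m) = win (blink e) 0 (2 * n) @ win (blink e) 0 m"
proof -
  have "win (blink e) (0 + int (2 * n)) m = win (blink e) (0 + int (2 * n) + - int (2 * n)) m"
    by (rule win_cong) (simp add: blink_def)
  then show ?thesis unfolding win_add by simp
qed

lemma run_append': "run G (u @ w) = (\<lambda>s. Option.bind (run G u s) (run G w))"
  by (rule ext) (rule run_append)

context
  fixes G :: "('v, 'e) pre_digraph" and e
  assumes e: "e \<in> arcs G"
begin

lemma run_pair: "run G (win (blink e) 0 2) s = (if fst s = tail G e then Some s else None)"
  using e by (cases s) (auto simp: numeral_2_eq_2 blink_def)

text \<open>One pair acts as a partial identity and is therefore idempotent. At least one pair must
  be present, since the empty word does not restrict the vertex.\<close>

lemma run_pairs: "run G (win (blink e) 0 (2 * Suc j)) = run G (win (blink e) 0 2)"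
proof (induction j)
  case (Suc j)
  have "win (blink e) 0 (2 * Suc (Suc j)) = win (blink e) 0 (2 * Suc j) @ (win (blink e) 0 2 :: ('v, 'e) gis_gen list)"
    by (metis add.commute mult_Suc_right win_blink_add)
  then have "run G (win (blink e) 0 (2 * Suc (Suc j))) = (\<lambda>s. Option.bind (run G (win (blink e) 0 2) s) (run G (win (blink e) 0 2)))"
    by (simp only: run_append' Suc)
  then show ?case by (simp only:) (simp add: run_pair fun_eq_iff)
qed (simp add: numeral_2_eq_2)

lemma run_pairs_tail: "run G (win (blink e) 0 (2 * j)) (tail G e, t) = Some (tail G e, t)"
  by (cases j) (simp_all only: run_pairs run_pair, auto)

lemma run_blink_prefix: "run G (win (blink e) 0 n) (tail G e, t) \<noteq> None"
  by (rule run_win_mono[of _ _ _ "2 * n"]) (simp_all add: run_pairs_tail)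

lemma runnable_pairs:
  "runnable G (u @ win (blink e) 0 (2 * Suc j) @ w) \<longleftrightarrow> runnable G (u @ win (blink e) 0 2 @ w)"
  by (simp only: runnable_def run_append' run_pairs)

lemma runnable_pair_iff:
  "runnable G (u @ win (blink e) 0 2 @ w) \<longleftrightarrow>
    (\<exists>s t. run G u s = Some (tail G e, t) \<and> run G w (tail G e, t) \<noteq> None)"
  unfolding runnable_def run_append
  by (auto simp: bind_eq_Some_conv run_pair split: if_splits) blast+

end

text \<open>The heteroclinic point that passes from the run of \<open>e\<close> to that of
  \<open>g\<close> through the word \<open>m\<close>, with cuts at 0 and at
  \<open>length m\<close>.\<close>

definition het :: "'e \<Rightarrow> ('v, 'e) gis_gen list \<Rightarrow> 'e \<Rightarrow> int \<Rightarrow> ('v, 'e) gis_gen" where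
  "het e m g i = (if i < 0 then blink e i else if i < int (length m) then m ! nat i else blink g (i - int (length m)))"

lemma lcut_het: "lcut e 0 (het e m g)"
  by (simp add: lcut_def het_def)

lemma rcut_het: "rcut g (int (length m)) (het e m g)"
  by (auto simp: rcut_def het_def)

lemma win_het: "win (het e m g) 0 (length m) = m"
  by (rule nth_equalityI) (simp_all add: nth_win het_def)

context wf_digraph
begin

text \<open>Runnability passes to factors, so windows that exhaust the integers suffice.\<close>

lemma MD_I:
  assumes "\<And>i. x i \<in> md_alphabet G" "\<And>m. \<exists>i n. i \<le> - int m \<and> int m \<le> i + int n \<and> runnable G (win x i n)"
  shows "x \<in> MD G"
  unfolding MD_iff
proof (intro conjI allI)
  fix i n
  obtain j k where "j \<le> - int (nat \<bar>i\<bar> + n)" "int (nat \<bar>i\<bar> + n) \<le> j + int k" "runnable G (win x j k)"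
    using assms(2) by blast
  then show "runnable G (win x i n)" by - (rule runnable_win_mono[of G x j k], simp_all)
qed (rule assms(1))

lemma het_MD:
  assumes "e \<in> arcs G" "g \<in> arcs G" "set m \<subseteq> md_alphabet G" "run G m (tail G e, t) = Some (tail G g, t')"
  shows "het e m g \<in> MD G"
proof (rule MD_I)
  fix i show "het e m g i \<in> md_alphabet G"
    using assms(1-3) by (auto simp: het_def blink_def md_alphabet_def subset_iff)
next
  fix n
  have "win (het e m g) (- 2 * int n) (2 * n + (length m + 2 * n)) = win (blink e) 0 (2 * n) @ m @ win (blink g) 0 (2 * n)"
    unfolding win_add using win_lcut[OF lcut_het[of e m g], of n] win_rcut[OF rcut_het[of g m e], of "2 * n"]
    by (simp add: win_het)
  moreover have "runnable G (win (blink e) 0 (2 * n) @ m @ win (blink g) 0 (2 * n))"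
    unfolding runnable_def using assms
    by (intro exI[of _ "(tail G e, t)"]) (simp add: run_append run_pairs_tail)
  ultimately show "\<exists>i k. i \<le> - int n \<and> int n \<le> i + int k \<and> runnable G (win (het e m g) i k)"
    by (intro exI[of _ "- 2 * int n"] exI[of _ "2 * n + (length m + 2 * n)"]) auto
qed

text \<open>The agreement at the seam forces the two runs into the same phase, so a whole positive
  number of pairs lies between the two cuts of the glued point. By \<open>run_pairs\<close> their
  number is irrelevant, and a single pair decides composability.\<close>

lemma composable_cut:
  assumes q: "q \<in> arcs G" and x: "x \<in> MD G" and y: "y \<in> MD G" and cx: "rcut q \<kappa> x" and cy: "lcut q \<nu> y"
  shows "composable (MD G) x y \<longleftrightarrow> (\<forall>m n. runnable G (win x (\<kappa> - int m) m @ win (blink q) 0 2 @ win y \<nu> n))"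
proof -
  have key: "win (glue x N y M) (\<kappa> - int m - N) (m + (2 * j + n)) = win x (\<kappa> - int m) m @ win (blink q) 0 (2 * j) @ win y \<nu> n"
    if N: "N \<ge> \<kappa>" and M: "- M \<le> \<nu>" and j: "N - \<kappa> + (M + \<nu>) = 2 * int j" for N M m n j
  proof -
    have "win (glue x N y M) (\<kappa> - int m - N) m = win x (\<kappa> - int m) m"
      using win_cong[of "\<kappa> - int m - N" m "glue x N y M" x N] N by (simp add: glue_def)
    moreover have "win (glue x N y M) (\<kappa> - N) (2 * j) = win (blink q) (\<kappa> - N + (N - \<kappa>)) (2 * j)"
    proof (rule win_cong)
      fix i assume i: "\<kappa> - N \<le> i" "i < \<kappa> - N + int (2 * j)"
      show "glue x N y M i = blink q (i + (N - \<kappa>))"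
      proof (cases "i < 0")
        case True
        then show ?thesis using i cx by (simp add: glue_def rcut_def algebra_simps)
      next
        case False
        have "i - M < \<nu>" using i j by simp
        then have "glue x N y M i = blink q (i - M - \<nu>)" using False cy by (simp add: glue_def lcut_def)
        also have "i + (N - \<kappa>) = i - M - \<nu> + 2 * int j" using j by simp
        then have "blink q (i - M - \<nu>) = blink q (i + (N - \<kappa>))" by (simp only: blink_def) simp
        finally show ?thesis .
      qed
    qed
    moreover have "win (glue x N y M) (M + \<nu>) n = win y \<nu> n"
      using win_cong[of "M + \<nu>" n "glue x N y M" y "- M"] M by (simp add: glue_def)
    moreover have "\<kappa> - int m - N + int m = \<kappa> - N" "\<kappa> - N + int (2 * j) = M + \<nu>" "\<kappa> - N + (N - \<kappa>) = 0"
      using j by auto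
    ultimately show ?thesis by (simp only: win_add)
  qed
  show ?thesis
  proof
    assume "composable (MD G) x y"
    then obtain K where K: "\<And>N M. N \<ge> int K \<Longrightarrow> M \<ge> int K \<Longrightarrow> agree K x N y (- M) \<Longrightarrow> glue x N y M \<in> MD G"
      by (auto simp: composable_def)
    \<comment> \<open>The even offsets \<open>2 * a\<close> match the phases of the two runs, and
      \<open>a\<close> is so large that the windows of radius \<open>K\<close> lie inside both
      tails. The glued point then has \<open>2 * a\<close> pairs between its cuts.\<close>
    define a where "a = K + nat \<bar>\<kappa>\<bar> + nat \<bar>\<nu>\<bar> + 1"
    define N where "N = \<kappa> + 2 * int a"
    define M where "M = 2 * int a - \<nu>"
    have ag: "agree K x N y (- M)"
      unfolding agree_def
    proof (intro allI impI)
      fix i assume i: "\<bar>i\<bar> \<le> int K"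
      have "x (N + i) = blink q (N + i - \<kappa>)" using cx i by (simp add: rcut_def N_def a_def)
      also have "\<dots> = blink q (- M + i - \<nu>)" by (simp add: blink_def N_def M_def)
      also have "\<dots> = y (- M + i)" using cy i by (simp add: lcut_def M_def a_def)
      finally show "x (N + i) = y (- M + i)" .
    qed
    have z: "glue x N y M \<in> MD G"
      by (rule K) (use ag in \<open>auto simp: N_def M_def a_def\<close>)
    show "\<forall>m n. runnable G (win x (\<kappa> - int m) m @ win (blink q) 0 2 @ win y \<nu> n)"
    proof (intro allI)
      fix m n
      have "runnable G (win (glue x N y M) (\<kappa> - int m - N) (m + (2 * (2 * a) + n)))"
        using z by (simp only: MD_iff)
      also have "win (glue x N y M) (\<kappa> - int m - N) (m + (2 * (2 * a) + n)) = win x (\<kappa> - int m) m @ win (blink q) 0 (2 * (2 * a)) @ win y \<nu> n"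
        by (rule key) (auto simp: N_def M_def a_def)
      also have "2 * a = Suc (2 * a - 1)" by (simp add: a_def)
      finally show "runnable G (win x (\<kappa> - int m) m @ win (blink q) 0 2 @ win y \<nu> n)"
        by (simp only: runnable_pairs[OF q])
    qed
  next
    assume R: "\<forall>m n. runnable G (win x (\<kappa> - int m) m @ win (blink q) 0 2 @ win y \<nu> n)"
    define K where "K = nat \<bar>\<kappa>\<bar> + nat \<bar>\<nu>\<bar> + 1"
    show "composable (MD G) x y"
      unfolding composable_def
    proof (intro exI[of _ K] allI impI)
      fix N M assume NM: "int K \<le> N" "int K \<le> M" and ag: "agree K x N y (- M)"
      \<comment> \<open>The central letters alone force the phases to agree: an opening bracket
        meets an opening one. The bound \<open>K\<close> makes the resulting number of pairs
        positive, hence \<open>Suc J\<close>.\<close>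
      have "x (N + 0) = y (- M + 0)" using ag unfolding agree_def by (metis abs_zero of_nat_0_le_iff)
      moreover have "x N = blink q (N - \<kappa>)" using cx NM by (simp add: rcut_def K_def)
      moreover have "y (- M) = blink q (- M - \<nu>)" using cy NM by (simp add: lcut_def K_def)
      ultimately have "even (N - \<kappa>) \<longleftrightarrow> even (- M - \<nu>)" by (auto simp: blink_def split: if_splits)
      then have "even (N - \<kappa> + (M + \<nu>))" by (auto simp: even_add even_diff)
      then obtain j where j: "N - \<kappa> + (M + \<nu>) = 2 * j" unfolding dvd_def by blast
      define J where "J = nat (j - 1)"
      have J: "N - \<kappa> + (M + \<nu>) = 2 * int (Suc J)" using j NM by (simp add: J_def K_def)
      show "glue x N y M \<in> MD G"
      proof (rule MD_I)
        fix i show "glue x N y M i \<in> md_alphabet G"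
          using x y by (simp add: glue_def MD_iff)
      next
        fix k
        define m where "m = k + nat \<bar>N\<bar> + nat \<bar>\<kappa>\<bar>"
        define n where "n = k + nat \<bar>M\<bar> + nat \<bar>\<nu>\<bar>"
        have "runnable G (win (glue x N y M) (\<kappa> - int m - N) (m + (2 * Suc J + n)))"
        proof (subst key)
          show "runnable G (win x (\<kappa> - int m) m @ win (blink q) 0 (2 * Suc J) @ win y \<nu> n)"
            using R by (simp only: runnable_pairs[OF q])
        qed (use NM J in \<open>auto simp: K_def\<close>)
        moreover have "\<kappa> - int m - N \<le> - int k" using NM unfolding m_def K_def by linarith
        moreover have "int k \<le> \<kappa> - int m - N + int (m + (2 * Suc J + n))" using J NM unfolding n_def K_def of_nat_add by linarith
        ultimately show "\<exists>i n. i \<le> - int k \<and> int k \<le> i + int n \<and> runnable G (win (glue x N y M) i n)"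
          by blast
      qed
    qed
  qed
qed

lemma MD_lcut_run:
  assumes "y \<in> MD G" "lcut g \<xi> y" "g \<in> arcs G"
  shows "\<exists>t. run G (win y \<xi> n) (tail G g, t) \<noteq> None"
proof -
  have "win y (\<xi> - 2) (2 + n) = win (blink g) 0 2 @ win y \<xi> n"
    unfolding win_add using win_lcut[OF assms(2), of 1] by simp
  then have "runnable G ([] @ win (blink g) 0 2 @ win y \<xi> n)"
    using assms(1) unfolding MD_iff by (metis append_Nil)
  then show ?thesis unfolding runnable_pair_iff[OF assms(3)] by auto
qed

lemma MD_rcut_run:
  assumes "u \<in> MD G" "rcut e \<kappa> u" "e \<in> arcs G"
  shows "\<exists>s t. run G (win u (\<kappa> - int a) a) s = Some (tail G e, t)"
proof -
  have "win u (\<kappa> - int a) (a + 2) = win u (\<kappa> - int a) a @ win (blink e) 0 2 @ []"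
    unfolding win_add using win_rcut[OF assms(2)] by simp
  then have "runnable G (win u (\<kappa> - int a) a @ win (blink e) 0 2 @ [])"
    using assms(1) unfolding MD_iff by metis
  then show ?thesis unfolding runnable_pair_iff[OF assms(3)] by auto
qed

lemma MD_mid_run:
  assumes x: "x \<in> MD G" and c: "lcut e \<nu> x" "rcut g (\<nu> + int m) x" and e: "e \<in> arcs G" and g: "g \<in> arcs G"
  shows "\<exists>t t'. run G (win x \<nu> m) (tail G e, t) = Some (tail G g, t')"
proof -
  have "win x (\<nu> - 2) (2 + (m + 2)) = win (blink e) 0 2 @ win x \<nu> m @ win (blink g) 0 2"
    unfolding win_add using win_lcut[OF c(1), of 1] win_rcut[OF c(2)] by simp
  then have "runnable G ([] @ win (blink e) 0 2 @ win x \<nu> m @ win (blink g) 0 2)"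
    using x unfolding MD_iff by (metis append_Nil)
  then obtain t where "run G (win x \<nu> m @ win (blink g) 0 2) (tail G e, t) \<noteq> None"
    unfolding runnable_pair_iff[OF e] by auto
  then show ?thesis
    by (auto simp: run_append bind_eq_Some_conv run_pair[OF g] split: if_splits)
qed

text \<open>A pair of the left tail fixes the vertex where the middle of \<open>x\<close> starts,
  and the middle then leaves \<open>k\<close> on top of whatever was there. Conversely, the pairs of
  the left tail run on every stack, so the rest \<open>t\<close> is at choice and may depend on
  \<open>n\<close>.\<close>

lemma composable_iff_future:
  assumes x: "x \<in> MD G" and c: "lcut e \<nu> x" "rcut g (\<nu> + int m) x" and e: "e \<in> arcs G" and g: "g \<in> arcs G"
    and push: "pushes G (win x \<nu> m) (tail G e) k (tail G g)"
    and y: "y \<in> MD G" "lcut g \<xi> y"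
  shows "composable (MD G) x y \<longleftrightarrow> (\<forall>n. \<exists>t. run G (win y \<xi> n) (tail G g, k @ t) \<noteq> None)"
proof -
  have split: "win x (\<nu> + int m - int (2 * b + m)) (2 * b + m) = win (blink e) 0 (2 * b) @ win x \<nu> m" for b
    unfolding win_add using win_lcut[OF c(1), of b] by simp
  show ?thesis
    unfolding composable_cut[OF g x y(1) c(2) y(2)]
  proof (intro iffI allI)
    fix n
    assume "\<forall>a n. runnable G (win x (\<nu> + int m - int a) a @ win (blink g) 0 2 @ win y \<xi> n)"
    then have "runnable G ((win (blink e) 0 (2 * 1) @ win x \<nu> m) @ win (blink g) 0 2 @ win y \<xi> n)"
      unfolding split[symmetric] by blast
    then obtain s t where "run G (win (blink e) 0 (2 * 1) @ win x \<nu> m) s = Some (tail G g, t)"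
      and r: "run G (win y \<xi> n) (tail G g, t) \<noteq> None"
      unfolding runnable_pair_iff[OF g] by blast
    then obtain t' where "run G (win x \<nu> m) (tail G e, t') = Some (tail G g, t)"
      by (cases s) (auto simp: run_append bind_eq_Some_conv run_pair[OF e] split: if_splits)
    then have "t = k @ t'" using push by (simp add: pushes_def)
    then show "\<exists>t. run G (win y \<xi> n) (tail G g, k @ t) \<noteq> None" using r by blast
  next
    fix a n
    assume "\<forall>n. \<exists>t. run G (win y \<xi> n) (tail G g, k @ t) \<noteq> None"
    then obtain t where t: "run G (win y \<xi> n) (tail G g, k @ t) \<noteq> None" by blast
    have "run G (win (blink e) 0 (2 * a) @ win x \<nu> m) (tail G e, t) = Some (tail G g, k @ t)"
      using push by (simp add: run_append run_pairs_tail[OF e] pushes_def)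
    then have run: "runnable G ((win (blink e) 0 (2 * a) @ win x \<nu> m) @ win (blink g) 0 2 @ win y \<xi> n)"
      unfolding runnable_pair_iff[OF g] using t by blast
    \<comment> \<open>A window of length \<open>a\<close> that ends at the right cut is a suffix of
      one that consists of \<open>a\<close> whole pairs and the entire middle.\<close>
    have "win x (\<nu> + int m - int (2 * a + m)) (a + m + a) = win x (\<nu> + int m - int (2 * a + m)) (a + m) @ win x (\<nu> + int m - int a) a"
      unfolding win_add[of x _ "a + m" a] by simp
    moreover have "a + m + a = 2 * a + m" by simp
    ultimately have "win x (\<nu> + int m - int (2 * a + m)) (2 * a + m) = win x (\<nu> + int m - int (2 * a + m)) (a + m) @ win x (\<nu> + int m - int a) a"
      by (simp only:)
    with run have "runnable G (win x (\<nu> + int m - int (2 * a + m)) (a + m) @ (win x (\<nu> + int m - int a) a @ win (blink g) 0 2 @ win y \<xi> n) @ [])"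
      unfolding split[symmetric] by simp
    then show "runnable G (win x (\<nu> + int m - int a) a @ win (blink g) 0 2 @ win y \<xi> n)"
      by (rule runnable_factor)
  qed
qed

text \<open>A middle part that only pushes runs on every stack, so any past that arrives at
  \<open>tail G e\<close> may precede it.\<close>

lemma pushes_imp_left_free:
  assumes x: "x \<in> MD G" and c: "lcut e \<nu> x" "rcut g (\<nu> + int m) x" and e: "e \<in> arcs G" and g: "g \<in> arcs G"
    and push: "pushes G (win x \<nu> m) (tail G e) k (tail G g)"
  shows "left_free (MD G) (blink e) x"
  unfolding left_free_def
proof (intro ballI impI)
  fix u assume u: "u \<in> MD G" "right_asymp (blink e) u"
  then obtain \<kappa> where \<kappa>: "rcut e \<kappa> u" by (auto simp: right_asymp_blink_iff)
  show "composable (MD G) u x"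
    unfolding composable_cut[OF e u(1) x \<kappa> c(1)]
  proof (intro allI)
    fix a n
    obtain s t where st: "run G (win u (\<kappa> - int a) a) s = Some (tail G e, t)"
      using MD_rcut_run[OF u(1) \<kappa> e] by blast
    have "win x \<nu> (m + n) = win x \<nu> m @ win (blink g) 0 n"
      unfolding win_add using win_rcut[OF c(2)] by simp
    then have "run G (win x \<nu> (m + n)) (tail G e, t) \<noteq> None"
      using push run_blink_prefix[OF g] by (simp add: run_append pushes_def)
    then have "run G (win x \<nu> n) (tail G e, t) \<noteq> None" by (rule run_win_mono) simp
    then show "runnable G (win u (\<kappa> - int a) a @ win (blink e) 0 2 @ win x \<nu> n)"
      unfolding runnable_pair_iff[OF e] using st by blast
  qed
qed

end

lemma left_asymp_shift: "left_asymp (shift p) x \<longleftrightarrow> left_asymp p x" and right_asymp_shift: "right_asymp (shift p) x \<longleftrightarrow> right_asymp p x"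
proof -
  have "left_asymp p x" if "left_asymp (shift p) x" using that unfolding left_asymp_def shift_def by (metis add.assoc)
  moreover have "left_asymp (shift p) x" if left_asymp: "left_asymp p x"
  proof -
    obtain n K where "\<forall>i\<le>K. x i = p (i + n)" using left_asymp unfolding left_asymp_def by blast
    then show ?thesis unfolding left_asymp_def shift_def by (intro exI[of _ "n - 1"] exI[of _ K]) simp
  qed
  ultimately show "left_asymp (shift p) x \<longleftrightarrow> left_asymp p x" by blast
  have "right_asymp p x" if "right_asymp (shift p) x" using that unfolding right_asymp_def shift_def by (metis add.assoc)
  moreover have "right_asymp (shift p) x" if right_asymp: "right_asymp p x"
  proof -
    obtain n K where "\<forall>i\<ge>K. x i = p (i + n)" using right_asymp unfolding right_asymp_def by blast
    then show ?thesis unfolding right_asymp_def shift_def by (intro exI[of _ "n - 1"] exI[of _ K]) simp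
  qed
  ultimately show "right_asymp (shift p) x \<longleftrightarrow> right_asymp p x" by blast
qed

lemma futures_shift: "futures X (shift q) = futures X q"
  by (simp add: futures_def left_asymp_shift)

lemma nbhds_shift: "nbhds X (shift p) q = nbhds X p q" "nbhds X p (shift q) = nbhds X p q"
  by (simp_all add: nbhds_def nbhd_def left_free_def left_asymp_shift right_asymp_shift)

lemma eqv_shift: "eqv X (shift p) q = eqv X p q" "eqv X p (shift q) = eqv X p q"
  by (simp_all add: eqv_def nbhds_shift futures_shift)

lemma arrows_shift: "arrows X (shift p) q = arrows X p q" "arrows X p (shift q) = arrows X p q"
  by (simp_all add: arrows_def nbhds_shift futures_shift)

section \<open>Walks of the contracted graph\<close>

locale one_edge_forest = fin_digraph G for G :: "('v, 'e) pre_digraph" +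
  fixes r c w :: 'v and f :: 'e
  assumes verts_eq: "verts G = {r, c, w}" and distinct: "r \<noteq> c" "r \<noteq> w" "c \<noteq> w"
    and F_eq: "F_edges G = {f}" and tail_f: "tail G f = r" and head_f: "head G f = c"
    and strong: "strongly_connected G"
begin

lemma f_arc: "f \<in> arcs G"
  using F_eq by (auto simp: F_edges_def)

lemma head_c: "e \<in> arcs G \<Longrightarrow> head G e = c \<longleftrightarrow> e = f"
  using F_edges_unique[of f G e] F_eq head_f by auto

lemma walk_exists: "u \<in> verts G \<Longrightarrow> v \<in> verts G \<Longrightarrow> \<exists>p. awalk u p v"
  using strong by (auto simp: strongly_connected_def reachable_awalk)

lemma in_arc:
  assumes "A \<in> {r, w}" shows "\<exists>e\<in>arcs G. e \<noteq> f \<and> head G e = A"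
proof -
  obtain u where "u \<in> verts G" "u \<noteq> A" using assms verts_eq distinct by auto
  then obtain p where p: "awalk u p A" using walk_exists[of u A] assms verts_eq by auto
  then show ?thesis
  proof (cases p rule: rev_cases)
    case Nil
    then show ?thesis using p \<open>u \<noteq> A\<close> by auto
  next
    case (snoc p' e)
    then have "e \<in> arcs G" "head G e = A" using p by (auto simp: awalk_simps)
    then show ?thesis using assms head_f distinct by auto
  qed
qed

lemma out_arc:
  assumes "v \<in> verts G" shows "\<exists>e\<in>arcs G. tail G e = v"
proof -
  obtain u where "u \<in> verts G" "u \<noteq> v" using assms verts_eq distinct by auto
  then obtain p where p: "awalk v p u" using walk_exists[of v u] assms by auto
  then show ?thesis
    using \<open>u \<noteq> v\<close> by (cases p) (auto simp: awalk_simps)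
qed

text \<open>An edge other than \<open>f\<close> is not the only one into its target, so every root
  has two incoming edges. This choice provides the brackets that tell stacks apart.\<close>

lemma in_arc_avoid:
  assumes "A \<in> {r, w}" shows "\<exists>e\<in>arcs G. e \<noteq> f \<and> head G e = A \<and> e \<noteq> e'"
proof -
  obtain e where e: "e \<in> arcs G" "e \<noteq> f" "head G e = A" using in_arc[OF assms] by blast
  then have "in_arcs G (head G e) \<noteq> {e}" using F_eq by (auto simp: F_edges_def)
  then obtain e2 where "e2 \<in> arcs G" "head G e2 = A" "e2 \<noteq> e"
    using e by (auto simp: in_arcs_def)
  then show ?thesis using e assms head_f distinct by (cases "e = e'") auto
qed

text \<open>The root of the tree that contains \<open>v\<close>, that is, the vertex of the
  contracted graph to which \<open>v\<close> is contracted.\<close>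

definition cl :: "'v \<Rightarrow> 'v" where
  "cl v = (if v = c then r else v)"

lemma cl_verts: "v \<in> verts G \<Longrightarrow> cl v \<in> {r, w}"
  using verts_eq distinct by (auto simp: cl_def)

lemma cl_head: "e \<in> arcs G \<Longrightarrow> e \<noteq> f \<Longrightarrow> cl (head G e) = head G e"
  by (auto simp: cl_def head_c)

lemma cl_f: "cl (head G f) = cl (tail G f)"
  by (simp add: cl_def head_f tail_f)

text \<open>Walks of the contracted graph, listed from their last edge to their first.\<close>

fun cwalk :: "'v \<Rightarrow> 'e list \<Rightarrow> 'v \<Rightarrow> bool" where
  "cwalk A [] B \<longleftrightarrow> A = B"
| "cwalk A (e # k) B \<longleftrightarrow> e \<in> arcs G \<and> e \<noteq> f \<and> head G e = B \<and> cwalk A k (cl (tail G e))"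

lemma cwalk_snoc:
  "cwalk A k B \<Longrightarrow> e \<in> arcs G \<Longrightarrow> e \<noteq> f \<Longrightarrow> head G e = A \<Longrightarrow> cwalk (cl (tail G e)) (k @ [e]) B"
  by (induction k arbitrary: B) auto

text \<open>The stack spells a walk of the contracted graph up to the current root: \<open>f\<close>
  moves inside a tree, and every other edge adds or removes the last edge of the walk.\<close>

lemma run_cwalk:
  "run G m (v, t) = Some (v', t') \<Longrightarrow> set m \<subseteq> md_alphabet G \<Longrightarrow> cwalk A t (cl v) \<Longrightarrow> cwalk A t' (cl v')"
proof (induction m arbitrary: v t)
  case (Cons a m)
  then obtain v1 t1 where a: "gact G a (v, t) = Some (v1, t1)" and m: "run G m (v1, t1) = Some (v', t')"
    by (auto simp: bind_eq_Some_conv)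
  have "cwalk A t1 (cl v1)"
    using a Cons.prems(2,3) F_eq cl_head cl_f
    by (auto simp: md_alphabet_def split: if_splits list.splits)
  then show ?case using Cons.IH[OF m] Cons.prems(2) by simp
qed auto

text \<open>A move inside a tree that leaves the stack alone, possible because \<open>f\<close> is
  unrecorded.\<close>

definition silent :: "'v \<Rightarrow> 'v \<Rightarrow> ('v, 'e) gis_gen list" where
  "silent v v' = (if v = v' then [] else if v = r then [Minus f] else [Plus f])"

lemma silent_pushes:
  assumes "v \<in> verts G" "v' \<in> verts G" "cl v = cl v'" shows "pushes G (silent v v') v [] v'"
  using assms verts_eq distinct f_arc F_eq
  by (auto simp: pushes_def silent_def cl_def head_f tail_f split: if_splits)

lemma silent_alphabet: "set (silent v v') \<subseteq> md_alphabet G"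
  using f_arc by (auto simp: silent_def md_alphabet_def)

text \<open>Consecutive edges of a contracted walk need not meet in the same vertex of
  \<open>G\<close>, but they meet in the same tree, where a silent move bridges the gap.\<close>

lemma cwalk_push:
  assumes "v \<in> verts G" "v' \<in> verts G" "cwalk (cl v) k (cl v')"
  shows "\<exists>m. set m \<subseteq> md_alphabet G \<and> pushes G m v k v'"
  using assms(2,3)
proof (induction k arbitrary: v')
  case Nil
  then show ?case using silent_pushes[of v v'] silent_alphabet assms(1) by auto
next
  case (Cons e k)
  then have e: "e \<in> arcs G" "e \<noteq> f" "head G e = cl v'" "cwalk (cl v) k (cl (tail G e))" by auto
  then obtain m where m: "set m \<subseteq> md_alphabet G" "pushes G m v k (tail G e)"
    using Cons.IH[of "tail G e"] by auto
  have "pushes G [Minus e] (tail G e) [e] (head G e)"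
    using e F_eq by (simp add: pushes_def)
  moreover have "cl (head G e) = cl v'" using cl_head[OF e(1,2)] e(3) by simp
  then have "pushes G (silent (head G e) v') (head G e) [] v'"
    using e(1) Cons.prems(1) by (intro silent_pushes) auto
  ultimately have "pushes G ([Minus e] @ silent (head G e) v') (tail G e) [e] v'"
    using pushes_append by fastforce
  then have "pushes G (m @ [Minus e] @ silent (head G e) v') v (e # k) v'"
    using pushes_append[OF m(2)] by fastforce
  moreover have "set (m @ [Minus e] @ silent (head G e) v') \<subseteq> md_alphabet G"
    using m e silent_alphabet by (auto simp: md_alphabet_def)
  ultimately show ?case by blast
qed

lemma cwalk_exists:
  assumes "v \<in> verts G" "v' \<in> verts G" shows "\<exists>k. cwalk (cl v) k (cl v')"
proof -
  obtain p where p: "awalk v p v'" using walk_exists assms by blast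
  then have "set (map Minus p) \<subseteq> md_alphabet G" by (auto simp: md_alphabet_def awalk_def)
  then show ?thesis using run_cwalk[OF run_Minus_walk[OF p, of "[]"], of "cl v"] by auto
qed

lemma MD_win_alphabet: "x \<in> MD G \<Longrightarrow> set (win x i n) \<subseteq> md_alphabet G"
  by (auto simp: set_win MD_iff)

text \<open>If the middle of \<open>x\<close> had to pop \<open>e1\<close> first, a past whose top
  bracket is another edge \<open>e2\<close> into the same root could not precede it.\<close>

lemma left_free_imp_pushes:
  assumes x: "x \<in> MD G" and c: "lcut e \<nu> x" "rcut g (\<nu> + int m) x" and e: "e \<in> arcs G" and g: "g \<in> arcs G"
    and lf: "left_free (MD G) (blink e) x"
  shows "\<exists>k. pushes G (win x \<nu> m) (tail G e) k (tail G g)"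
proof -
  obtain t t' where "run G (win x \<nu> m) (tail G e, t) = Some (tail G g, t')"
    using MD_mid_run[OF x c e g] by blast
  from run_factor[OF MD_win_alphabet[OF x] this]
  obtain h k where h: "\<And>u. run G (win x \<nu> m) (tail G e, h @ u) = Some (tail G g, k @ u)"
    "\<And>u. run G (win x \<nu> m) (tail G e, u) \<noteq> None \<Longrightarrow> \<exists>u'. u = h @ u'" by blast
  have "h = []"
  proof (rule ccontr)
    assume "h \<noteq> []"
    then obtain e1 h' where h': "h = e1 # h'" by (cases h) auto
    obtain e2 where e2: "e2 \<in> arcs G" "e2 \<noteq> f" "head G e2 = cl (tail G e)" "e2 \<noteq> e1"
      using in_arc_avoid cl_verts e by (metis tail_in_verts)
    then have cw: "cwalk (cl (tail G e2)) [e2] (cl (tail G e))" by simp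
    obtain m' where m': "set m' \<subseteq> md_alphabet G" "pushes G m' (tail G e2) [e2] (tail G e)"
      using cwalk_push[OF tail_in_verts[OF e2(1)] tail_in_verts[OF e] cw] by blast
    define u where "u = het e2 m' e"
    have u: "u \<in> MD G" unfolding u_def
      by (rule het_MD[where t = "[]"]) (use e e2 m' in \<open>auto simp: pushes_def\<close>)
    have lc: "lcut e2 0 u" and rc: "rcut e (0 + int (length m')) u"
      using lcut_het[of e2 m' e] rcut_het[of e m' e2] by (simp_all add: u_def)
    have "composable (MD G) u x"
      using lf u rc unfolding left_free_def right_asymp_blink_iff by blast
    moreover have "win u 0 (length m') = m'" unfolding u_def by (rule win_het)
    then have "pushes G (win u 0 (length m')) (tail G e2) [e2] (tail G e)" using m'(2) by simp
    ultimately obtain t where "run G (win x \<nu> m) (tail G e, [e2] @ t) \<noteq> None"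
      using composable_iff_future[OF u lc rc e2(1) e _ x c(1)] by blast
    then show False using h(2)[of "[e2] @ t"] h' e2(4) by auto
  qed
  then show ?thesis using h(1) by (auto simp: pushes_def)
qed

text \<open>The form that a neighbourhood takes here: the futures that tolerate \<open>k\<close> on
  top of the stack.\<close>

definition push_futures :: "'e \<Rightarrow> 'e list \<Rightarrow> (int \<Rightarrow> ('v, 'e) gis_gen) set" where
  "push_futures g k = {y \<in> MD G. \<exists>\<xi>. lcut g \<xi> y \<and> (\<forall>n. \<exists>t. run G (win y \<xi> n) (tail G g, k @ t) \<noteq> None)}"

lemma nbhd_eq_push_futures:
  assumes "x \<in> MD G" "lcut e \<nu> x" "rcut g (\<nu> + int m) x" "e \<in> arcs G" "g \<in> arcs G"
    "pushes G (win x \<nu> m) (tail G e) k (tail G g)"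
  shows "nbhd (MD G) (blink g) x = push_futures g k"
  unfolding nbhd_def push_futures_def left_asymp_blink_iff using composable_iff_future[OF assms] by blast

lemma futures_eq_push_futures: "g \<in> arcs G \<Longrightarrow> futures (MD G) (blink g) = push_futures g []"
  unfolding futures_def push_futures_def left_asymp_blink_iff append_Nil using MD_lcut_run by blast

lemma push_futures_append: "push_futures g (k @ l) \<subseteq> push_futures g k"
  by (auto simp: push_futures_def) metis

lemma cwalk_point:
  assumes "e \<in> arcs G" "g \<in> arcs G" "cwalk (cl (tail G e)) k (cl (tail G g))"
  obtains x m where "x \<in> MD G" "lcut e 0 x" "rcut g (0 + int m) x" "pushes G (win x 0 m) (tail G e) k (tail G g)"
proof -
  obtain m where m: "set m \<subseteq> md_alphabet G" "pushes G m (tail G e) k (tail G g)"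
    using cwalk_push[OF _ _ assms(3)] assms(1,2) by auto
  show thesis
  proof (rule that[of "het e m g" "length m"])
    show "het e m g \<in> MD G"
      by (rule het_MD[where t = "[]"]) (use assms m in \<open>auto simp: pushes_def\<close>)
  qed (use lcut_het[of e m g] rcut_het[of g m e] m win_het[of e m g] in auto)
qed

text \<open>The middle of a left free point pushes a walk of the contracted graph, and conversely
  every walk is pushed by a heteroclinic point, which is left free.\<close>

lemma nbhds_eq:
  assumes e: "e \<in> arcs G" and g: "g \<in> arcs G"
  shows "nbhds (MD G) (blink e) (blink g) = {push_futures g k | k. cwalk (cl (tail G e)) k (cl (tail G g))}"
proof (intro subset_antisym subsetI)
  fix S assume "S \<in> nbhds (MD G) (blink e) (blink g)"
  then obtain x where x: "x \<in> MD G" "left_asymp (blink e) x" "right_asymp (blink g) x" "left_free (MD G) (blink e) x"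
    and S: "S = nbhd (MD G) (blink g) x" by (auto simp: nbhds_def)
  obtain \<nu> where \<nu>: "lcut e \<nu> x" using x(2) by (auto simp: left_asymp_blink_iff)
  \<comment> \<open>The right cut is taken beyond the left one so that the middle part has
    nonnegative length.\<close>
  obtain \<kappa> where "\<kappa> \<ge> \<nu>" "rcut g \<kappa> x" using x(3) rcut_above by (metis right_asymp_blink_iff)
  then have \<kappa>: "rcut g (\<nu> + int (nat (\<kappa> - \<nu>))) x" by simp
  obtain k where k: "pushes G (win x \<nu> (nat (\<kappa> - \<nu>))) (tail G e) k (tail G g)"
    using left_free_imp_pushes[OF x(1) \<nu> \<kappa> e g x(4)] by blast
  then have "run G (win x \<nu> (nat (\<kappa> - \<nu>))) (tail G e, []) = Some (tail G g, k)"
    by (metis append_Nil2 pushes_def)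
  then have "cwalk (cl (tail G e)) k (cl (tail G g))"
    using run_cwalk MD_win_alphabet[OF x(1)] by (metis cwalk.simps(1))
  then show "S \<in> {push_futures g k | k. cwalk (cl (tail G e)) k (cl (tail G g))}"
    using nbhd_eq_push_futures[OF x(1) \<nu> \<kappa> e g k] S by blast
next
  fix S assume "S \<in> {push_futures g k | k. cwalk (cl (tail G e)) k (cl (tail G g))}"
  then obtain k where k: "S = push_futures g k" "cwalk (cl (tail G e)) k (cl (tail G g))" by blast
  obtain x m where x: "x \<in> MD G" "lcut e 0 x" "rcut g (0 + int m) x" "pushes G (win x 0 m) (tail G e) k (tail G g)"
    using cwalk_point[OF e g k(2)] by blast
  then have "x \<in> {x \<in> MD G. left_asymp (blink e) x \<and> right_asymp (blink g) x \<and> left_free (MD G) (blink e) x}"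
    using pushes_imp_left_free[OF x(1-3) e g x(4)] by (auto simp: left_asymp_blink_iff right_asymp_blink_iff)
  then show "S \<in> nbhds (MD G) (blink e) (blink g)"
    unfolding nbhds_def using nbhd_eq_push_futures[OF x(1-3) e g x(4)] k(1) by blast
qed

text \<open>The inverse of a word that pushes \<open>k\<close> pops \<open>k\<close>. The resulting
  future tests stacks: its first \<open>n\<close> letters run only if \<open>k\<close> is on
  top.\<close>

lemma pop_point:
  assumes g: "g \<in> arcs G" and e: "e \<in> arcs G" and k: "cwalk (cl (tail G e)) k (cl (tail G g))"
  obtains y n where "y \<in> MD G" "lcut g 0 y" "right_asymp (blink e) y" "\<And>n. run G (win y 0 n) (tail G g, k) \<noteq> None"
    "\<And>t. run G (win y 0 n) (tail G g, t) \<noteq> None \<Longrightarrow> \<exists>u. t = k @ u"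
proof -
  obtain m where m: "set m \<subseteq> md_alphabet G" "pushes G m (tail G e) k (tail G g)"
    using cwalk_push[OF _ _ k] g e by auto
  define m' where "m' = inv_word m"
  have m': "set m' \<subseteq> md_alphabet G" "\<And>t. run G m' (tail G g, k @ t) = Some (tail G e, t)"
    using inv_word_alphabet[OF m(1)] pops_inv[OF m] by (auto simp: m'_def pops_def)
  define y where "y = het g m' e"
  show thesis
  proof (rule that)
    show "y \<in> MD G" unfolding y_def using m' g e by (intro het_MD) auto
    show "lcut g 0 y" unfolding y_def by (rule lcut_het)
    show "right_asymp (blink e) y" unfolding y_def right_asymp_blink_iff using rcut_het[of e m' g] by blast
    show "run G (win y 0 n) (tail G g, k) \<noteq> None" for n
    proof -
      have "win y 0 (length m' + n) = m' @ win (blink e) 0 n"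
        unfolding win_add y_def win_het using win_rcut[OF rcut_het[of e m' g], of n] by simp
      then have "run G (win y 0 (length m' + n)) (tail G g, k) \<noteq> None"
        using m'(2)[of "[]"] run_blink_prefix[OF e, of n "[]"] by (simp add: run_append)
      then show ?thesis by (rule run_win_mono) simp
    qed
    show "\<exists>u. t = k @ u" if "run G (win y 0 (length m')) (tail G g, t) \<noteq> None" for t
    proof -
      \<comment> \<open>On the stack \<open>k\<close> the word ends with an empty stack; this forces
        \<open>s = []\<close>, so the least stack \<open>h\<close> is all of
        \<open>k\<close>.\<close>
      obtain h l s where "k = h @ s" "[] = l @ s" "\<And>u. run G m' (tail G g, u) \<noteq> None \<Longrightarrow> \<exists>u'. u = h @ u'"
        using run_factor[OF m'(1), of "tail G g" k "tail G e" "[]"] m'(2)[of "[]"] by auto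
      then show ?thesis using that by (auto simp: y_def win_het)
    qed
  qed
qed

text \<open>
  Two points that pop \<open>k\<close> and then one of two different edges lie in \<open>push_futures g k\<close>; a list
  compatible with both is a prefix of \<open>k\<close>.
\<close>

lemma push_futures_subset_imp_prefix:
  assumes g: "g \<in> arcs G" and e: "e \<in> arcs G" "e' \<in> arcs G"
    and k: "cwalk (cl (tail G e)) k (cl (tail G g))" "cwalk (cl (tail G e')) k' (cl (tail G g))"
    and sub: "push_futures g k \<subseteq> push_futures g k'"
  shows "\<exists>l. k = k' @ l"
proof -
  have comparable: "\<exists>t u. k' @ t = k @ a # u" if a: "a \<in> arcs G" "a \<noteq> f" "head G a = cl (tail G e)" for a
  proof -
    obtain y n where y: "y \<in> MD G" "lcut g 0 y" "\<And>n. run G (win y 0 n) (tail G g, k @ [a]) \<noteq> None"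
      "\<And>t. run G (win y 0 n) (tail G g, t) \<noteq> None \<Longrightarrow> \<exists>u. t = (k @ [a]) @ u"
      using pop_point[OF g a(1) cwalk_snoc[OF k(1) a]] by metis
    then have "y \<in> push_futures g k" unfolding push_futures_def by blast
    then have "y \<in> push_futures g k'" using sub by blast
    moreover obtain x m where x: "x \<in> MD G" "lcut e' 0 x" "rcut g (0 + int m) x" "pushes G (win x 0 m) (tail G e') k' (tail G g)"
      using cwalk_point[OF e(2) g k(2)] by blast
    ultimately have "composable (MD G) x y"
      using nbhd_eq_push_futures[OF x(1-3) e(2) g x(4)] by (auto simp: nbhd_def)
    then obtain t where "run G (win y 0 n) (tail G g, k' @ t) \<noteq> None"
      using composable_iff_future[OF x(1-3) e(2) g x(4) y(1,2)] by blast
    from y(4)[OF this] show ?thesis by auto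
  qed
  have A: "cl (tail G e) \<in> {r, w}" using e cl_verts by auto
  obtain a where a: "a \<in> arcs G" "a \<noteq> f" "head G a = cl (tail G e)" using in_arc[OF A] by blast
  obtain b where b: "b \<in> arcs G" "b \<noteq> f" "head G b = cl (tail G e)" "b \<noteq> a" using in_arc_avoid[OF A] by blast
  obtain t u t' u' where "k' @ t = k @ a # u" "k' @ t' = k @ b # u'"
    using comparable[OF a] comparable[OF b(1-3)] by blast
  then show ?thesis
    using b(4) by (auto simp: append_eq_append_conv2 append_eq_Cons_conv Cons_eq_append_conv)
qed

lemma push_futures_inj:
  assumes "g \<in> arcs G" "e \<in> arcs G" "e' \<in> arcs G"
    "cwalk (cl (tail G e)) k (cl (tail G g))" "cwalk (cl (tail G e')) k' (cl (tail G g))"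
    "push_futures g k = push_futures g k'"
  shows "k = k'"
  using push_futures_subset_imp_prefix[of g e e' k k'] push_futures_subset_imp_prefix[of g e' e k' k] assms by auto

end

section \<open>Points of period two\<close>

lemma length_filter_win:
  assumes "\<And>j. P (x j) \<Longrightarrow> \<alpha> \<le> j \<and> j < \<alpha> + int D"
  shows "length (filter P (win x i n)) \<le> D"
proof -
  have "length (filter P (win x i n)) = card {j. j < n \<and> P (x (i + int j))}"
    unfolding length_filter_conv_card by (rule arg_cong[where f = card]) (auto simp: nth_win)
  also have "\<dots> \<le> card {\<alpha>..<\<alpha> + int D}"
  proof (rule card_inj_on_le)
    show "inj_on (\<lambda>j. i + int j) {j. j < n \<and> P (x (i + int j))}" by (auto simp: inj_on_def)
    show "(\<lambda>j. i + int j) ` {j. j < n \<and> P (x (i + int j))} \<subseteq> {\<alpha>..<\<alpha> + int D}" using assms by auto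
  qed simp
  finally show ?thesis by simp
qed

lemma gact_vertex:
  "a \<in> md_alphabet G \<Longrightarrow> gact G a (v, t) \<noteq> None \<Longrightarrow> gact G a (v', t') \<noteq> None \<Longrightarrow> v = v'"
  by (auto simp: md_alphabet_def split: if_splits)

lemma inv_word_inv: "set m \<subseteq> md_alphabet G \<Longrightarrow> inv_word (inv_word m) = m"
  by (induction m) (auto simp: inv_word_def md_alphabet_def)

lemma filter_Plus_inv_word:
  "set m \<subseteq> md_alphabet G \<Longrightarrow> length (filter (\<lambda>a. a \<in> range Plus) (inv_word m)) = length (filter (\<lambda>a. a \<in> range Minus) m)"
  by (induction m) (auto simp: inv_word_def md_alphabet_def)

lemma win_glue: "win (glue x N y M) (- int a) (a + b) = win x (N - int a) a @ win y (- M) b"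
  unfolding win_add using win_cong[of "- int a" a "glue x N y M" x N] win_cong[of 0 b "glue x N y M" y "- M"]
  by (simp add: glue_def)

lemma shift_shift_fixed:
  assumes "shift (shift p) = p" shows "p i = (if even i then p 0 else p 1)"
proof -
  have 2: "p (i + 2) = p i" for i
    using fun_cong[OF assms, of i] by (simp add: shift_def add.assoc)
  have "p (i + 2 * k) = p i" for i k
  proof (induction k rule: int_induct[where k = 0])
    case (step1 k)
    then show ?case using 2[of "i + 2 * k"] by (simp add: algebra_simps)
  next
    case (step2 k)
    then show ?case using 2[of "i + 2 * (k - 1)"] by (simp add: algebra_simps)
  qed simp
  from this[of "i mod 2" "i div 2"] show ?thesis
    by (simp add: even_iff_mod_2_eq_zero odd_iff_mod_2_eq_one)
qed

lemma left_asymp_bound: "left_asymp p x \<Longrightarrow> (\<And>i. P (p i)) \<Longrightarrow> \<exists>K. \<forall>i\<le>K. P (x i)"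
  unfolding left_asymp_def by metis

lemma right_asymp_bound: "right_asymp p x \<Longrightarrow> (\<And>i. P (p i)) \<Longrightarrow> \<exists>K. \<forall>i\<ge>K. P (x i)"
  unfolding right_asymp_def by metis

lemma asymp_bounded:
  assumes "left_asymp p x" "right_asymp p x" "\<And>i. P (p i)"
  shows "\<exists>\<alpha> D. \<forall>j. \<not> P (x j) \<longrightarrow> \<alpha> \<le> j \<and> j < \<alpha> + int D"
proof -
  obtain K where K: "\<And>i. i \<le> K \<Longrightarrow> P (x i)" using left_asymp_bound[OF assms(1), of P] assms(3) by blast
  obtain L where L: "\<And>i. i \<ge> L \<Longrightarrow> P (x i)" using right_asymp_bound[OF assms(2), of P] assms(3) by blast
  have "K \<le> j \<and> j < K + int (nat (L - K))" if "\<not> P (x j)" for j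
    using K[of j] L[of j] that by linarith
  then show ?thesis by blast
qed

lemma shift2_blink: "shift (shift (blink e)) = blink e"
  by (simp add: shift_def blink_def fun_eq_iff)

section \<open>Shift invariance and compactness of Markov-Dyck shifts\<close>

lemma (in wf_digraph) shift_invariant_MD: "shift_invariant (MD G)"
proof -
  have "win (shift_by k x) i n = win x (i + k) n" for x :: "int \<Rightarrow> ('a, 'b) gis_gen" and k i n
    by (rule win_cong) (simp add: shift_by_def)
  then show ?thesis
    unfolding shift_invariant_def by (auto simp: MD_iff) (simp add: shift_by_def)
qed

lemma (in wf_digraph) shift_MD: "x \<in> MD G \<Longrightarrow> shift x \<in> MD G"
  using shift_invariant_MD shift_shift_by[of 0 x] by (auto simp: shift_invariant_def shift_by_def)

text \<open>Membership is decided on finite windows, so it passes to limits.\<close>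

lemma (in fin_digraph) compact_MD: "compact_space (shift_topology (MD G))"
proof (rule compact_shift_topology)
  show "finite (md_alphabet G)" by (simp add: md_alphabet_def)
  show "x i \<in> md_alphabet G" if "x \<in> MD G" for x i using that by (simp add: MD_def)
next
  fix x assume ex: "\<And>n. \<exists>y\<in>MD G. \<forall>i. \<bar>i\<bar> \<le> int n \<longrightarrow> y i = x i"
  show "x \<in> MD G"
    unfolding MD_iff
  proof (intro conjI allI)
    fix i
    obtain y where "y \<in> MD G" "\<forall>j. \<bar>j\<bar> \<le> int (nat \<bar>i\<bar>) \<longrightarrow> y j = x j" using ex by blast
    then show "x i \<in> md_alphabet G" by (auto simp: MD_iff dest!: spec[of _ i])
  next
    fix i n
    obtain y where y: "y \<in> MD G" "\<And>j. \<bar>j\<bar> \<le> int (nat \<bar>i\<bar> + n) \<Longrightarrow> y j = x j" using ex by blast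
    have "win x i n = win y (i + 0) n" by (rule win_cong) (use y(2) in auto)
    then show "runnable G (win x i n)" using y(1) by (simp add: MD_iff)
  qed
qed

lemma run_win_first: "run G (win x i (Suc n)) s \<noteq> None \<Longrightarrow> gact G (x i) s \<noteq> None"
  by (cases "gact G (x i) s") auto

lemma run_append_not_None:
  "run G (u @ w) s \<noteq> None \<longleftrightarrow> (\<exists>s'. run G u s = Some s' \<and> run G w s' \<noteq> None)"
  by (cases "run G u s") (auto simp: run_append)

lemma (in wf_digraph) MD_run: "x \<in> MD G \<Longrightarrow> \<exists>v t. run G (win x i n) (v, t) \<noteq> None"
  unfolding MD_iff runnable_def by (metis surj_pair)

lemma (in wf_digraph) MD_end:
  assumes "x \<in> MD G" shows "\<exists>s v t. run G (win x (j - int a) a) s = Some (v, t) \<and> gact G (x j) (v, t) \<noteq> None"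
proof -
  have "win x (j - int a) (a + 1) = win x (j - int a) a @ [x j]" unfolding win_add by simp
  then obtain v t where "run G (win x (j - int a) a @ [x j]) (v, t) \<noteq> None"
    using MD_run[OF assms, of "j - int a" "a + 1"] by metis
  then obtain v' t' where "run G (win x (j - int a) a) (v, t) = Some (v', t')" "run G [x j] (v', t') \<noteq> None"
    unfolding run_append_not_None by (metis surj_pair)
  moreover from this(2) have "gact G (x j) (v', t') \<noteq> None" by (auto simp: bind_eq_Some_conv)
  ultimately show ?thesis by blast
qed

section \<open>Neutral points and the contracted graph\<close>

context one_edge_forest
begin

text \<open>The unrecorded edge \<open>f\<close> is not a loop, so at least every second opening bracket is pushed.\<close>

lemma minus_pushes:
  assumes "set P \<subseteq> Minus ` arcs G" "run G P (v, t) = Some (v', t')"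
  shows "\<exists>k. pushes G P v k v' \<and> length P \<le> 2 * length k + (if v' = c then 1 else 0)"
  using assms
proof (induction P arbitrary: v' t' rule: rev_induct)
  case Nil
  then show ?case by (auto simp: pushes_def)
next
  case (snoc a P)
  then obtain e where a: "a = Minus e" and e: "e \<in> arcs G" by auto
  from snoc.prems obtain v1 t1 where P: "run G P (v, t) = Some (v1, t1)" and ga: "gact G a (v1, t1) = Some (v', t')"
    by (auto simp: run_append bind_eq_Some_conv)
  from snoc.IH[OF _ P] snoc.prems(1) obtain k where k: "pushes G P v k v1"
    "length P \<le> 2 * length k + (if v1 = c then 1 else 0)" by auto
  have v: "v1 = tail G e" "v' = head G e" using ga by (auto simp: a split: if_splits)
  show ?case
  proof (cases "e = f")
    \<comment> \<open>Here \<open>v1 = r\<close> and \<open>v' = c\<close>. The slack was not yet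
      used before this letter, and it now pays for \<open>f\<close>.\<close>
    case True
    then have "pushes G (P @ [a]) v k v'"
      using k(1) v e F_eq by (auto simp: pushes_def run_append a)
    then show ?thesis using k(2) v True tail_f head_f distinct by auto
  next
    case False
    then have "pushes G (P @ [a]) v (e # k) v'"
      using k(1) v e F_eq by (auto simp: pushes_def run_append a)
    moreover have "length (P @ [a]) \<le> 2 * length (e # k) + (if v' = c then 1 else 0)"
      using k(2) by (auto split: if_splits)
    ultimately show ?thesis by blast
  qed
qed

text \<open>The prefix \<open>P\<close> pushes at least as many edges as \<open>Q\<close> contains
  closing brackets, so \<open>Q\<close> never reaches the initial stack. The factor 2 and the
  summand 1 are those of \<open>minus_pushes\<close>.\<close>

lemma free_run:
  assumes P: "set P \<subseteq> Minus ` arcs G" and Q: "set Q \<subseteq> md_alphabet G"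
    and run: "run G (P @ Q) (v, t) \<noteq> None"
    and len: "2 * length (filter (\<lambda>a. a \<in> range Plus) Q) + 1 \<le> length P"
  shows "run G (P @ Q) (v, u) \<noteq> None"
proof -
  from run obtain v1 t1 v2 t2 where 1: "run G P (v, t) = Some (v1, t1)" and 2: "run G Q (v1, t1) = Some (v2, t2)"
    by (auto simp: run_append bind_eq_Some_conv)
  from minus_pushes[OF P 1] obtain k where k: "pushes G P v k v1" "length P \<le> 2 * length k + (if v1 = c then 1 else 0)"
    by blast
  from run_factor[OF Q 2] obtain h l s where h: "t1 = h @ s" "\<And>u. run G Q (v1, h @ u) = Some (v2, l @ u)"
    "length h \<le> length (filter (\<lambda>a. a \<in> range Plus) Q)" by blast
  have "t1 = k @ t" using k(1) 1 by (simp add: pushes_def)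
  moreover have "length h \<le> length k" using h(3) k(2) len by (auto split: if_splits)
  ultimately obtain k' where "k = h @ k'" using h(1) by (auto simp: append_eq_append_conv2)
  then show ?thesis using h(2)[of "k' @ u"] k(1) by (simp add: run_append pushes_def)
qed

text \<open>Far to the left \<open>y\<close> only opens brackets, so many that its boundedly many
  closing brackets never see the past across the seam.\<close>

lemma composable_minus:
  assumes x: "x \<in> MD G" and y: "y \<in> MD G"
    and b: "\<And>j. y j \<in> range Plus \<Longrightarrow> \<alpha> \<le> j \<and> j < \<alpha> + int D"
  shows "composable (MD G) x y"
  unfolding composable_def
proof (intro exI[of _ "nat \<bar>\<alpha>\<bar> + 2 * D + 2"] allI impI)
  fix N M
  assume M: "int (nat \<bar>\<alpha>\<bar> + 2 * D + 2) \<le> M" and ag: "agree (nat \<bar>\<alpha>\<bar> + 2 * D + 2) x N y (- M)"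
  have "x (N + 0) = y (- M + 0)" using ag unfolding agree_def by (metis abs_zero of_nat_0_le_iff)
  then have xy: "x N = y (- M)" by simp
  show "glue x N y M \<in> MD G"
  proof (rule MD_I)
    show "glue x N y M i \<in> md_alphabet G" for i using x y by (simp add: glue_def MD_iff)
  next
    fix k
    define p where "p = 2 * D + 1"
    obtain s v t where U: "run G (win x (N - int k) k) s = Some (v, t)" "gact G (x N) (v, t) \<noteq> None"
      using MD_end[OF x] by blast
    obtain v2 t2 where V: "run G (win y (- M) (p + k)) (v2, t2) \<noteq> None"
      using MD_run[OF y] by blast
    moreover have "p + k = Suc (2 * D + k)" by (simp add: p_def)
    ultimately have "gact G (y (- M)) (v2, t2) \<noteq> None" by (metis run_win_first)
    \<comment> \<open>A bracket can be read at one vertex only, so the common letter at the seam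
      makes the two vertices coincide.\<close>
    then have "v2 = v" using gact_vertex U(2) xy y by (metis MD_iff)
    have eq: "win y (- M) (p + k) = win y (- M) p @ win y (- M + int p) k" by (rule win_add)
    have "run G (win y (- M) p @ win y (- M + int p) k) (v, t) \<noteq> None"
    proof (rule free_run)
      show "set (win y (- M) p) \<subseteq> Minus ` arcs G"
      proof -
        have "y j \<in> Minus ` arcs G" if "j < - M + int p" for j
        proof -
          have "y j \<notin> range Plus" using b[of j] that M by (auto simp: p_def)
          moreover have "y j \<in> md_alphabet G" using y by (simp add: MD_iff)
          ultimately show ?thesis by (auto simp: md_alphabet_def)
        qed
        then show ?thesis by (auto simp: set_win)
      qed
      show "run G (win y (- M) p @ win y (- M + int p) k) (v, t2) \<noteq> None"
        using V unfolding eq \<open>v2 = v\<close> .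
      show "2 * length (filter (\<lambda>a. a \<in> range Plus) (win y (- M + int p) k)) + 1 \<le> length (win y (- M) p)"
        using length_filter_win[of "\<lambda>a. a \<in> range Plus" y \<alpha> D "- M + int p" k] b by (simp add: p_def)
    qed (use y MD_win_alphabet in auto)
    then have "runnable G (win (glue x N y M) (- int k) (k + (p + k)))"
      unfolding win_glue eq runnable_def using U(1) by (intro exI[of _ s]) (simp add: run_append)
    then show "\<exists>i n. i \<le> - int k \<and> int k \<le> i + int n \<and> runnable G (win (glue x N y M) i n)"
      by (intro exI[of _ "- int k"] exI[of _ "k + (p + k)"]) auto
  qed
qed

text \<open>The mirror image of the preceding lemma: the inverse words, read from the seam back into
  \<open>x\<close>, begin with a long run of opening brackets.\<close>

lemma composable_plus:
  assumes x: "x \<in> MD G" and y: "y \<in> MD G"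
    and b: "\<And>j. x j \<in> range Minus \<Longrightarrow> \<alpha> \<le> j \<and> j < \<alpha> + int D"
  shows "composable (MD G) x y"
  unfolding composable_def
proof (intro exI[of _ "nat \<bar>\<alpha>\<bar> + 3 * D + 2"] allI impI)
  fix N M
  assume N: "int (nat \<bar>\<alpha>\<bar> + 3 * D + 2) \<le> N" and ag: "agree (nat \<bar>\<alpha>\<bar> + 3 * D + 2) x N y (- M)"
  have "x (N + 0) = y (- M + 0)" using ag unfolding agree_def by (metis abs_zero of_nat_0_le_iff)
  then have xy: "x N = y (- M)" by simp
  show "glue x N y M \<in> MD G"
  proof (rule MD_I)
    show "glue x N y M i \<in> md_alphabet G" for i using x y by (simp add: glue_def MD_iff)
  next
    fix k
    \<comment> \<open>Beyond these \<open>p\<close> letters the bound on \<open>N\<close> contains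
      another \<open>D\<close>, since the run of closing brackets starts after the exceptional
      block, not before it.\<close>
    define p where "p = 2 * D + 1"
    define U where "U = win x (N - int (k + p)) (k + p)"
    have Ua: "set U \<subseteq> md_alphabet G" unfolding U_def using MD_win_alphabet[OF x] .
    obtain s v1 t1 where U: "run G U s = Some (v1, t1)" "gact G (x N) (v1, t1) \<noteq> None"
      unfolding U_def using MD_end[OF x] by blast
    obtain v t where V: "run G (win y (- M) (1 + k)) (v, t) \<noteq> None"
      using MD_run[OF y] by blast
    then have "gact G (y (- M)) (v, t) \<noteq> None" by (metis plus_1_eq_Suc run_win_first)
    then have "v1 = v" using gact_vertex U(2) xy y by (metis MD_iff)
    have Ueq: "U = win x (N - int (k + p)) k @ win x (N - int p) p"
      unfolding U_def win_add by simp
    have "run G (inv_word (win x (N - int p) p) @ inv_word (win x (N - int (k + p)) k)) (v, t) \<noteq> None"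
    proof (rule free_run)
      show "set (inv_word (win x (N - int p) p)) \<subseteq> Minus ` arcs G"
      proof -
        have "flip (x j) \<in> Minus ` arcs G" if "N - int p \<le> j" for j
        proof -
          have "x j \<notin> range Minus" using b[of j] that N by (auto simp: p_def)
          moreover have "x j \<in> md_alphabet G" using x by (simp add: MD_iff)
          ultimately show ?thesis by (auto simp: md_alphabet_def)
        qed
        then show ?thesis by (auto simp: set_win inv_word_def)
      qed
      show "run G (inv_word (win x (N - int p) p) @ inv_word (win x (N - int (k + p)) k)) (v, t1) \<noteq> None"
        using run_inv_word[OF Ua U(1)] \<open>v1 = v\<close> unfolding Ueq inv_word_append by simp
      show "2 * length (filter (\<lambda>a. a \<in> range Plus) (inv_word (win x (N - int (k + p)) k))) + 1 \<le> length (inv_word (win x (N - int p) p))"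
        using length_filter_win[of "\<lambda>a. a \<in> range Minus" x \<alpha> D "N - int (k + p)" k] b
        unfolding filter_Plus_inv_word[OF MD_win_alphabet[OF x]] by (simp add: p_def inv_word_def)
      show "set (inv_word (win x (N - int (k + p)) k)) \<subseteq> md_alphabet G"
        using inv_word_alphabet[OF MD_win_alphabet[OF x]] .
    qed
    then obtain s' where "run G (inv_word U) (v, t) = Some s'"
      unfolding Ueq inv_word_append by blast
    then have "run G U s' = Some (v, t)"
      using run_inv_word[OF inv_word_alphabet[OF Ua]] by (simp add: inv_word_inv[OF Ua])
    then have "runnable G (win (glue x N y M) (- int (k + p)) (k + p + (1 + k)))"
      unfolding win_glue runnable_def using V by (intro exI[of _ s']) (simp add: run_append U_def)
    then show "\<exists>i n. i \<le> - int k \<and> int k \<le> i + int n \<and> runnable G (win (glue x N y M) i n)"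
      by (intro exI[of _ "- int (k + p)"] exI[of _ "k + p + (1 + k)"]) auto
  qed
qed

lemma blink_MD: "e \<in> arcs G \<Longrightarrow> blink e \<in> MD G"
proof -
  assume e: "e \<in> arcs G"
  have "het e [] e \<in> MD G" by (rule het_MD) (use e in auto)
  moreover have "het e [] e = (blink e :: int \<Rightarrow> ('v, 'e) gis_gen)" by (simp add: het_def fun_eq_iff)
  ultimately show ?thesis by simp
qed

text \<open>Two closed walks of the contracted graph at the root of \<open>tail G e\<close> end in
  different edges \<open>a\<close> and \<open>b\<close>. A point that pushes the first and one that
  pops the second both have the required tails, but are not composable.\<close>

lemma blink_neut:
  assumes e: "e \<in> arcs G" shows "blink e \<in> neut (MD G)"
proof -
  have A: "cl (tail G e) \<in> {r, w}" using e cl_verts by auto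
  obtain a where a: "a \<in> arcs G" "a \<noteq> f" "head G a = cl (tail G e)" using in_arc[OF A] by blast
  obtain b where b: "b \<in> arcs G" "b \<noteq> f" "head G b = cl (tail G e)" "b \<noteq> a" using in_arc_avoid[OF A] by blast
  obtain k k' where "cwalk (cl (tail G e)) k (cl (tail G a))" "cwalk (cl (tail G e)) k' (cl (tail G b))"
    using cwalk_exists e a b by (meson tail_in_verts)
  then have k: "cwalk (cl (tail G e)) (a # k) (cl (tail G e))" "cwalk (cl (tail G e)) (b # k') (cl (tail G e))"
    using a b by auto
  obtain x m where x: "x \<in> MD G" "lcut e 0 x" "rcut e (0 + int m) x" "pushes G (win x 0 m) (tail G e) (a # k) (tail G e)"
    using cwalk_point[OF e e k(1)] by blast
  obtain y n where y: "y \<in> MD G" "lcut e 0 y" "right_asymp (blink e) y"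
    "\<And>t. run G (win y 0 n) (tail G e, t) \<noteq> None \<Longrightarrow> \<exists>u. t = (b # k') @ u"
    using pop_point[OF e e k(2)] by metis
  have "\<not> composable (MD G) x y"
  proof
    assume "composable (MD G) x y"
    then obtain t where "run G (win y 0 n) (tail G e, (a # k) @ t) \<noteq> None"
      using composable_iff_future[OF x(1-3) e e x(4) y(1,2)] by blast
    from y(4)[OF this] show False using b(4) by auto
  qed
  moreover have "left_asymp (blink e) x" "right_asymp (blink e) x" "left_asymp (blink e) y"
    using x(2,3) y(2) by (auto simp: left_asymp_blink_iff right_asymp_blink_iff)
  ultimately have "\<exists>x\<in>MD G. \<exists>y\<in>MD G. left_asymp (blink e) x \<and> right_asymp (blink e) x \<and> left_asymp (blink e) y \<and> right_asymp (blink e) y \<and> \<not> composable (MD G) x y"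
    using x(1) y(1,3) by (intro bexI[of _ x] bexI[of _ y] conjI)
  then show ?thesis by (simp add: neut_def blink_MD[OF e] shift2_blink)
qed

lemma neut_shift: "p \<in> neut (MD G) \<Longrightarrow> shift p \<in> neut (MD G)"
  by (auto simp: neut_def left_asymp_shift right_asymp_shift shift_MD)

lemma minus_plus_eq:
  assumes "e \<in> arcs G" "runnable G [Minus e, Plus g]" shows "g = e"
  using assms F_edges_unique[of e G g] F_edges_unique[of g G e]
  by (auto simp: runnable_def split: if_splits list.splits)

text \<open>A bracket that opens and then closes must be matched by its own partner. If both letters
  open or both close, all points with these tails are composable, so the witness for
  \<open>neut\<close> cannot exist.\<close>

lemma neut_cases:
  assumes "p \<in> neut (MD G)" shows "\<exists>e\<in>arcs G. p = blink e \<or> p = shift (blink e)"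
proof -
  have p: "p \<in> MD G" "shift (shift p) = p" using assms by (auto simp: neut_def)
  note alt = shift_shift_fixed[OF p(2)]
  obtain x y where xy: "x \<in> MD G" "y \<in> MD G" "left_asymp p x" "right_asymp p x" "left_asymp p y" "right_asymp p y" "\<not> composable (MD G) x y"
    using assms by (auto simp: neut_def)
  have al: "x i \<in> range Plus \<longleftrightarrow> x i \<notin> range Minus" if "x \<in> MD G" for x i
  proof -
    have "x i \<in> md_alphabet G" using that by (simp add: MD_iff)
    then show ?thesis by (auto simp: md_alphabet_def)
  qed
  have "p 0 \<in> md_alphabet G" "p 1 \<in> md_alphabet G" using p(1) by (auto simp: MD_iff)
  then consider e g where "p 0 = Minus e" "p 1 = Plus g" "e \<in> arcs G" | e g where "p 0 = Plus g" "p 1 = Minus e" "e \<in> arcs G"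
    | e g where "p 0 = Minus e" "p 1 = Minus g" | e g where "p 0 = Plus e" "p 1 = Plus g"
    by (auto simp: md_alphabet_def)
  then show ?thesis
  proof cases
    case 1
    have "runnable G (win p 0 2)" using p(1) by (simp only: MD_iff)
    then have "g = e" using 1 minus_plus_eq by (simp add: numeral_2_eq_2)
    then have "p i = blink e i" for i using 1 alt[of i] by (simp add: blink_def)
    then have "p = blink e" ..
    then show ?thesis using 1(3) by blast
  next
    case 2
    have "runnable G (win p 1 2)" using p(1) by (simp only: MD_iff)
    then have "g = e" using 2 minus_plus_eq alt[of 2] by (simp add: numeral_2_eq_2)
    then have "p i = shift (blink e) i" for i using 2 alt[of i] by (simp add: blink_def shift_def)
    then have "p = shift (blink e)" ..
    then show ?thesis using 2(3) by blast
  next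
    case 3
    then have "p i \<in> range Minus" for i using alt[of i] by simp
    then obtain \<alpha> D where "\<forall>j. y j \<notin> range Minus \<longrightarrow> \<alpha> \<le> j \<and> j < \<alpha> + int D"
      using asymp_bounded[OF xy(5,6), of "\<lambda>a. a \<in> range Minus"] by blast
    then have "composable (MD G) x y" using composable_minus[OF xy(1,2)] al[OF xy(2)] by blast
    then show ?thesis using xy(7) by blast
  next
    case 4
    then have "p i \<in> range Plus" for i using alt[of i] by simp
    then obtain \<alpha> D where "\<forall>j. x j \<notin> range Plus \<longrightarrow> \<alpha> \<le> j \<and> j < \<alpha> + int D"
      using asymp_bounded[OF xy(3,4), of "\<lambda>a. a \<in> range Plus"] by blast
    then have "composable (MD G) x y" using composable_plus[OF xy(1,2)] al[OF xy(1)] by blast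
    then show ?thesis using xy(7) by blast
  qed
qed

text \<open>Inclusion of the sets \<open>push_futures g k\<close> is the reverse prefix order of the
  lists \<open>k\<close>, so the maximal ones below \<open>futures\<close> are those of one-edge
  lists.\<close>

lemma arrows_blink:
  assumes e: "e \<in> arcs G" and g: "g \<in> arcs G"
  shows "arrows (MD G) (blink e) (blink g) =
    (\<lambda>a. push_futures g [a]) ` {a \<in> arcs G. a \<noteq> f \<and> head G a = cl (tail G g) \<and> cl (tail G a) = cl (tail G e)}"
proof (intro subset_antisym subsetI)
  fix S assume S: "S \<in> arrows (MD G) (blink e) (blink g)"
  then obtain k where k: "S = push_futures g k" "cwalk (cl (tail G e)) k (cl (tail G g))"
    unfolding arrows_def nbhds_eq[OF e g] by blast
  have ne: "S \<noteq> push_futures g []" using S futures_eq_push_futures[OF g] by (simp add: arrows_def)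
  then obtain a l where al: "k = a # l" using k by (cases k) auto
  then have a: "a \<in> arcs G" "a \<noteq> f" "head G a = cl (tail G g)" using k(2) by auto
  have ca: "cwalk (cl (tail G a)) [a] (cl (tail G g))" using a by simp
  have "l = []"
  proof (rule ccontr)
    assume "l \<noteq> []"
    then have "push_futures g k \<noteq> push_futures g [a]" using push_futures_inj[OF g e a(1) k(2) ca] al by auto
    then have "push_futures g k \<subset> push_futures g [a]" using push_futures_append[of g "[a]" l] al by auto
    \<comment> \<open>Lists start with the last edge, so the prefix \<open>[a]\<close> is a final
      piece of the walk and may begin in a different tree. This is why \<open>arrows\<close>
      compares with neighbourhoods of all neutral points.\<close>
    moreover have "push_futures g [a] \<in> nbhds (MD G) (blink a) (blink g)" unfolding nbhds_eq[OF a(1) g] using ca by blast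
    ultimately have "push_futures g [a] = push_futures g []"
      using S blink_neut[OF a(1)] unfolding arrows_def futures_eq_push_futures[OF g] k(1) by blast
    then show False using push_futures_inj[OF g a(1) g ca, of "[]"] by simp
  qed
  then show "S \<in> (\<lambda>a. push_futures g [a]) ` {a \<in> arcs G. a \<noteq> f \<and> head G a = cl (tail G g) \<and> cl (tail G a) = cl (tail G e)}"
    using k al a by auto
next
  fix S assume "S \<in> (\<lambda>a. push_futures g [a]) ` {a \<in> arcs G. a \<noteq> f \<and> head G a = cl (tail G g) \<and> cl (tail G a) = cl (tail G e)}"
  then obtain a where a: "S = push_futures g [a]" "a \<in> arcs G" "a \<noteq> f" "head G a = cl (tail G g)" "cl (tail G a) = cl (tail G e)"
    by auto
  have ca: "cwalk (cl (tail G e)) [a] (cl (tail G g))" using a by simp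
  have "S \<in> nbhds (MD G) (blink e) (blink g)" unfolding nbhds_eq[OF e g] using ca a(1) by blast
  moreover have "S \<noteq> futures (MD G) (blink g)"
    unfolding futures_eq_push_futures[OF g] a(1) using push_futures_inj[OF g e g ca, of "[]"] by auto
  moreover have "S' = futures (MD G) (blink g)" if p': "p' \<in> neut (MD G)" "S' \<in> nbhds (MD G) p' (blink g)" "S \<subset> S'" for p' S'
  proof -
    obtain e' where e': "e' \<in> arcs G" "S' \<in> nbhds (MD G) (blink e') (blink g)"
      using neut_cases[OF p'(1)] p'(2) by (auto simp: nbhds_shift)
    then obtain k where k: "S' = push_futures g k" "cwalk (cl (tail G e')) k (cl (tail G g))"
      unfolding nbhds_eq[OF e'(1) g] by blast
    obtain l where "[a] = k @ l"
      using push_futures_subset_imp_prefix[OF g e e'(1) ca k(2)] p'(3) a(1) k(1) by auto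
    moreover have "k \<noteq> [a]" using p'(3) a(1) k(1) by auto
    ultimately have "k = []" by (auto simp: Cons_eq_append_conv)
    then show ?thesis using k(1) futures_eq_push_futures[OF g] by simp
  qed
  ultimately show "S \<in> arrows (MD G) (blink e) (blink g)" unfolding arrows_def by blast
qed

text \<open>The edges of the contracted graph from \<open>A\<close> to \<open>B\<close>.\<close>

definition carcs :: "'v \<Rightarrow> 'v \<Rightarrow> 'e set" where
  "carcs A B = {a \<in> arcs G. a \<noteq> f \<and> head G a = B \<and> cl (tail G a) = A}"

lemma card_arrows_blink:
  assumes e: "e \<in> arcs G" and g: "g \<in> arcs G"
  shows "card (arrows (MD G) (blink e) (blink g)) = card (carcs (cl (tail G e)) (cl (tail G g)))"
  unfolding arrows_blink[OF e g] carcs_def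
proof (rule card_image, rule inj_onI)
  fix a b assume "a \<in> {a \<in> arcs G. a \<noteq> f \<and> head G a = cl (tail G g) \<and> cl (tail G a) = cl (tail G e)}"
    "b \<in> {a \<in> arcs G. a \<noteq> f \<and> head G a = cl (tail G g) \<and> cl (tail G a) = cl (tail G e)}" "push_futures g [a] = push_futures g [b]"
  then show "a = b" using push_futures_inj[OF g e e, of "[a]" "[b]"] by auto
qed

lemma eqv_blink:
  assumes e: "e \<in> arcs G" and g: "g \<in> arcs G"
  shows "eqv (MD G) (blink e) (blink g) \<longleftrightarrow> cl (tail G e) = cl (tail G g)"
proof
  assume "eqv (MD G) (blink e) (blink g)"
  then obtain k where k: "push_futures g [] = push_futures g k" "cwalk (cl (tail G e)) k (cl (tail G g))"
    unfolding eqv_def nbhds_eq[OF e g] futures_eq_push_futures[OF g] by blast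
  then have "k = []" using push_futures_inj[OF g g e, of "[]" k] by simp
  then show "cl (tail G e) = cl (tail G g)" using k(2) by simp
next
  assume "cl (tail G e) = cl (tail G g)"
  then have "cwalk (cl (tail G e)) [] (cl (tail G g))" by simp
  then show "eqv (MD G) (blink e) (blink g)"
    unfolding eqv_def nbhds_eq[OF e g] futures_eq_push_futures[OF g] by blast
qed

text \<open>The factor 2 arises because \<open>blink e\<close> and its shift are distinct neutral
  points of the same orbit.\<close>

lemma card_eqv_blink:
  assumes g: "g \<in> arcs G"
  shows "card {q \<in> neut (MD G). eqv (MD G) q (blink g)} = 2 * card {e \<in> arcs G. cl (tail G e) = cl (tail G g)}"
    (is "card ?L = 2 * card ?S")
proof -
  let ?p = "blink :: 'e \<Rightarrow> int \<Rightarrow> ('v, 'e) gis_gen"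
  have "?L = ?p ` ?S \<union> (\<lambda>e. shift (?p e)) ` ?S"
  proof (intro subset_antisym subsetI)
    fix q assume "q \<in> ?L"
    then obtain e where "e \<in> arcs G" "q = blink e \<or> q = shift (blink e)" "eqv (MD G) (blink e) (blink g)"
      using neut_cases[of q] by (auto simp: eqv_shift)
    then show "q \<in> ?p ` ?S \<union> (\<lambda>e. shift (?p e)) ` ?S" using eqv_blink g by auto
  next
    fix q assume "q \<in> ?p ` ?S \<union> (\<lambda>e. shift (?p e)) ` ?S"
    then show "q \<in> ?L" using eqv_blink g blink_neut neut_shift by (auto simp: eqv_shift)
  qed
  moreover have "inj_on ?p ?S" "inj_on (\<lambda>e. shift (?p e)) ?S"
  proof -
    have "a = b" if "?p a = ?p b \<or> shift (?p a) = shift (?p b)" for a b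
    proof -
      have "?p a 0 = ?p b 0 \<or> shift (?p a) 0 = shift (?p b) 0" using that by auto
      then show ?thesis by (auto simp: blink_def shift_def)
    qed
    then show "inj_on ?p ?S" "inj_on (\<lambda>e. shift (?p e)) ?S" by (auto simp: inj_on_def)
  qed
  moreover have "?p ` ?S \<inter> (\<lambda>e. shift (?p e)) ` ?S = {}"
  proof -
    have "?p a \<noteq> shift (?p b)" for a b
    proof
      assume "?p a = shift (?p b)"
      from fun_cong[OF this, of 0] show False by (simp add: blink_def shift_def)
    qed
    then show ?thesis by auto
  qed
  ultimately show ?thesis by (simp add: card_Un_disjoint card_image)
qed

section \<open>Counting points of periods one and two\<close>

lemma minus_walk_MD:
  assumes "\<And>i. a i \<in> arcs G" "\<And>i. head G (a i) = tail G (a (i + 1))"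
  shows "(\<lambda>i. Minus (a i)) \<in> MD G"
proof -
  have "run G (win (\<lambda>i. Minus (a i)) i n) (tail G (a i), t) \<noteq> None" for i n t
    by (induction n arbitrary: i t) (use assms in auto)
  then show ?thesis unfolding MD_iff runnable_def using assms(1) by (auto simp: md_alphabet_def) blast
qed

lemma plus_walk_MD:
  assumes "\<And>i. a i \<in> arcs G" "\<And>i. tail G (a i) = head G (a (i + 1))"
  shows "(\<lambda>i. Plus (a i)) \<in> MD G"
proof -
  have "\<exists>t. run G (win (\<lambda>i. Plus (a i)) i n) (head G (a i), t) \<noteq> None" for i n
  proof (induction n arbitrary: i)
    case (Suc n)
    from Suc[of "i + 1"] obtain t where "run G (win (\<lambda>i. Plus (a i)) (i + 1) n) (tail G (a i), t) \<noteq> None"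
      by (auto simp: assms(2))
    \<comment> \<open>The stack is prepared backwards: each recorded edge has to be on top when its
      closing bracket is read.\<close>
    then show ?case using assms(1)
      by (intro exI[of _ "if a i \<in> F_edges G then t else a i # t"]) auto
  qed auto
  then show ?thesis unfolding MD_iff runnable_def using assms(1) by (auto simp: md_alphabet_def) blast
qed

lemma card_fixed_MD: "card {x \<in> MD G. shift x = x} = 2 * card {e \<in> arcs G. tail G e = head G e}"
    (is "card ?L = 2 * card ?S")
proof -
  let ?m = "(\<lambda>e _. Minus e) :: 'e \<Rightarrow> int \<Rightarrow> ('v, 'e) gis_gen"
  let ?q = "(\<lambda>e _. Plus e) :: 'e \<Rightarrow> int \<Rightarrow> ('v, 'e) gis_gen"
  have "?L = ?m ` ?S \<union> ?q ` ?S"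
  proof (intro subset_antisym subsetI)
    fix x assume x: "x \<in> ?L"
    then have s: "shift x = x" by simp
    have x1: "x i = x 0" for i
    proof -
      have "x 1 = x 0" using fun_cong[OF s, of 0] by (simp add: shift_def)
      then show ?thesis using shift_shift_fixed[of x i] s by simp
    qed
    have "runnable G (win x 0 2)" using x by (simp add: MD_iff)
    then have "runnable G [x 0, x 0]" using x1[of 1] by (simp add: numeral_2_eq_2)
    moreover have "x 0 \<in> md_alphabet G" using x by (simp add: MD_iff)
    then obtain e where e: "e \<in> arcs G" "x 0 = Minus e \<or> x 0 = Plus e"
      by (auto simp: md_alphabet_def)
    ultimately have "tail G e = head G e"
      by (auto simp: runnable_def split: if_splits list.splits)
    then have eS: "e \<in> ?S" using e(1) by simp
    have "x i = x 0" for i by (rule x1)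
    then have "x = (\<lambda>_. x 0)" by (rule ext)
    with e(2) have "x = (\<lambda>_. Minus e) \<or> x = (\<lambda>_. Plus e)" by (elim disjE) simp_all
    then show "x \<in> ?m ` ?S \<union> ?q ` ?S" using eS by blast
  next
    fix x assume "x \<in> ?m ` ?S \<union> ?q ` ?S"
    then show "x \<in> ?L" using minus_walk_MD[of "\<lambda>_. e" for e] plus_walk_MD[of "\<lambda>_. e" for e]
      by (auto simp: shift_def)
  qed
  moreover have "inj_on ?m ?S" "inj_on ?q ?S"
    by (auto simp: inj_on_def fun_eq_iff)
  moreover have "?m ` ?S \<inter> ?q ` ?S = {}"
    by (auto simp: fun_eq_iff)
  ultimately show ?thesis by (simp add: card_Un_disjoint card_image)
qed

text \<open>Ordered pairs, with \<open>e = g\<close> allowed for loops; this matches the points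
  \<open>x\<close> with \<open>shift (shift x) = x\<close>, which include the fixed points.\<close>

definition two_cycles :: "('e \<times> 'e) set" where
  "two_cycles = {(e, g). e \<in> arcs G \<and> g \<in> arcs G \<and> head G e = tail G g \<and> head G g = tail G e}"

lemma card_period2_MD: "card {x \<in> MD G. shift (shift x) = x \<and> x \<notin> neut (MD G)} = 2 * card two_cycles"
    (is "card ?L = _")
proof -
  define alt where "alt h = (\<lambda>(e, g) (i :: int). h (if even i then e else g))"
    for h :: "'e \<Rightarrow> ('v, 'e) gis_gen"
  have L: "?L = alt Minus ` two_cycles \<union> alt Plus ` two_cycles"
  proof (intro subset_antisym subsetI)
    fix x assume x: "x \<in> ?L"
    note al = shift_shift_fixed[of x]
    have "x 0 \<in> md_alphabet G" "x 1 \<in> md_alphabet G" using x by (auto simp: MD_iff)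
    \<comment> \<open>Three letters display both junctions of the periodic point.\<close>
    have run: "runnable G [x 0, x 1, x 0]"
    proof -
      have "runnable G (win x 0 3)" using x by (simp add: MD_iff)
      then show ?thesis using al[of 2] x by (simp add: numeral_3_eq_3)
    qed
    have run': "runnable G [x 1, x 0]" using runnable_factor[of G "[x 0]" "[x 1, x 0]" "[]"] run by simp
    have run'': "runnable G [x 0, x 1]" using runnable_factor[of G "[]" "[x 0, x 1]" "[x 0]"] run by simp
    consider e g where "x 0 = Minus e" "x 1 = Plus g" "e \<in> arcs G" | e g where "x 0 = Plus g" "x 1 = Minus e" "e \<in> arcs G"
      | e g where "x 0 = Minus e" "x 1 = Minus g" "e \<in> arcs G" "g \<in> arcs G"
      | e g where "x 0 = Plus e" "x 1 = Plus g" "e \<in> arcs G" "g \<in> arcs G"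
      using \<open>x 0 \<in> md_alphabet G\<close> \<open>x 1 \<in> md_alphabet G\<close> by (auto simp: md_alphabet_def)
    then show "x \<in> alt Minus ` two_cycles \<union> alt Plus ` two_cycles"
    proof cases
      case 1
      then have "g = e" using minus_plus_eq run'' by simp
      then have "x i = blink e i" for i using 1 al[of i] x by (simp add: blink_def)
      then have "x = blink e" ..
      then show ?thesis using x blink_neut 1(3) by simp
    next
      case 2
      then have "g = e" using minus_plus_eq run' by simp
      then have "x i = shift (blink e) i" for i using 2 al[of i] x by (simp add: blink_def shift_def)
      then have "x = shift (blink e)" ..
      then show ?thesis using x neut_shift[OF blink_neut] 2(3) by simp
    next
      case 3
      then have "(e, g) \<in> two_cycles" using run by (auto simp: two_cycles_def runnable_def split: if_splits)
      moreover have "x i = alt Minus (e, g) i" for i using 3 al[of i] x by (simp add: alt_def)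
      then have "x = alt Minus (e, g)" ..
      ultimately show ?thesis by blast
    next
      case 4
      then have "(e, g) \<in> two_cycles" using run by (auto simp: two_cycles_def runnable_def split: if_splits list.splits)
      moreover have "x i = alt Plus (e, g) i" for i using 4 al[of i] x by (simp add: alt_def)
      then have "x = alt Plus (e, g)" ..
      ultimately show ?thesis by blast
    qed
  next
    fix x assume "x \<in> alt Minus ` two_cycles \<union> alt Plus ` two_cycles"
    then obtain e g where eg: "(e, g) \<in> two_cycles" "x = alt Minus (e, g) \<or> x = alt Plus (e, g)" by auto
    have "x \<in> MD G"
      using eg minus_walk_MD[of "\<lambda>i. if even i then e else g"] plus_walk_MD[of "\<lambda>i. if even i then e else g"]
      by (auto simp: alt_def two_cycles_def)
    moreover have "shift (shift x) = x" using eg(2) by (auto simp: alt_def shift_def fun_eq_iff)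
    moreover have "x \<notin> neut (MD G)"
    proof
      assume "x \<in> neut (MD G)"
      then obtain h where "x = blink h \<or> x = shift (blink h)" using neut_cases by blast
      then have "x 0 = Minus h \<and> x 1 = Plus h \<or> x 0 = Plus h \<and> x 1 = Minus h"
        by (auto simp: blink_def shift_def)
      then show False using eg(2) by (auto simp: alt_def)
    qed
    ultimately show "x \<in> ?L" by simp
  qed
  have inj: "inj_on (alt h) two_cycles" if "inj h" for h
  proof (rule inj_onI)
    fix u v assume "alt h u = alt h v"
    from fun_cong[OF this, of 0] fun_cong[OF this, of 1] show "u = v"
      using that by (cases u; cases v) (auto simp: alt_def dest: injD)
  qed
  have card: "card (alt h ` two_cycles) = card two_cycles" if "inj h" for h
    using inj[OF that] by (rule card_image)
  have "alt Minus ` two_cycles \<inter> alt Plus ` two_cycles = {}"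
  proof -
    have "alt Minus u \<noteq> alt Plus v" for u v
    proof
      assume "alt Minus u = alt Plus v"
      from fun_cong[OF this, of 0] show False by (cases u; cases v) (simp add: alt_def)
    qed
    then show ?thesis by auto
  qed
  moreover have "finite two_cycles"
    by (rule finite_subset[of _ "arcs G \<times> arcs G"]) (auto simp: two_cycles_def)
  ultimately have "card ?L = card (alt Minus ` two_cycles) + card (alt Plus ` two_cycles)"
    unfolding L by (intro card_Un_disjoint) auto
  moreover have "card (alt Minus ` two_cycles) = card two_cycles" by (rule card) (simp add: inj_def)
  moreover have "card (alt Plus ` two_cycles) = card two_cycles" by (rule card) (simp add: inj_def)
  ultimately show ?thesis by linarith
qed

end

section \<open>Recovering the graph\<close>

definition between :: "('v, 'e) pre_digraph \<Rightarrow> 'v \<Rightarrow> 'v \<Rightarrow> 'e set" where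
  "between G u v = {e \<in> arcs G. tail G e = u \<and> head G e = v}"

lemma digraph_isoI:
  assumes "fin_digraph G" "fin_digraph G'" and inj: "inj_on \<pi> (verts G)" and im: "\<pi> ` verts G = verts G'"
    and card: "\<And>u v. u \<in> verts G \<Longrightarrow> v \<in> verts G \<Longrightarrow> card (between G u v) = card (between G' (\<pi> u) (\<pi> v))"
  shows "digraph_iso G G'"
proof -
  interpret G: fin_digraph G by fact
  interpret G': fin_digraph G' by fact
  have "\<exists>h. bij_betw h (between G u v) (between G' (\<pi> u) (\<pi> v))" if "u \<in> verts G" "v \<in> verts G" for u v
    using card[OF that] by (intro finite_same_card_bij) (simp_all add: between_def)
  then obtain h where h: "\<And>u v. u \<in> verts G \<Longrightarrow> v \<in> verts G \<Longrightarrow> bij_betw (h u v) (between G u v) (between G' (\<pi> u) (\<pi> v))"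
    by metis
  define k where "k e = h (tail G e) (head G e) e" for e
  have k: "k e \<in> between G' (\<pi> (tail G e)) (\<pi> (head G e))" if "e \<in> arcs G" for e
    using bij_betwE[OF h[of "tail G e" "head G e"]] that by (auto simp: k_def between_def)
  have k_inj: "inj_on k (arcs G)"
  proof (rule inj_onI)
    fix a b assume ab: "a \<in> arcs G" "b \<in> arcs G" "k a = k b"
    then have "\<pi> (tail G a) = \<pi> (tail G b)" "\<pi> (head G a) = \<pi> (head G b)"
      using k[of a] k[of b] by (auto simp: between_def)
    then have eq: "tail G a = tail G b" "head G a = head G b"
      using ab inj by (auto dest: inj_onD)
    have "inj_on (h (tail G a) (head G a)) (between G (tail G a) (head G a))"
      using h ab by (auto simp: bij_betw_def)
    then show "a = b" using ab eq by (auto simp: k_def between_def dest: inj_onD)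
  qed
  have k_im: "k ` arcs G = arcs G'"
  proof (intro subset_antisym subsetI)
    fix b assume b: "b \<in> arcs G'"
    then have "tail G' b \<in> \<pi> ` verts G" "head G' b \<in> \<pi> ` verts G" unfolding im by simp_all
    then obtain u v where uv: "u \<in> verts G" "v \<in> verts G" "\<pi> u = tail G' b" "\<pi> v = head G' b"
      by (auto elim!: imageE)
    then have "b \<in> between G' (\<pi> u) (\<pi> v)" using b by (simp add: between_def)
    then have "b \<in> h u v ` between G u v"
      using bij_betw_imp_surj_on[OF h[OF uv(1,2)]] by simp
    then obtain a where "a \<in> between G u v" "h u v a = b" by blast
    then show "b \<in> k ` arcs G" by (auto simp: between_def k_def)
  qed (use k in \<open>auto simp: between_def\<close>)
  \<comment> \<open>The images have to be equal as records, so the end maps of \<open>G'\<close> are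
    taken over as total functions.\<close>
  define hom where "hom = \<lparr>iso_verts = \<pi>, iso_arcs = k, iso_head = head G', iso_tail = tail G'\<rparr>"
  have "pre_digraph.digraph_isomorphism G hom"
    unfolding G.digraph_isomorphism_def
    using inj k_inj k G.wf_digraph_axioms by (auto simp: hom_def between_def)
  moreover have "G' = app_iso hom G"
    by (rule pre_digraph.equality) (simp_all add: hom_def im k_im)
  ultimately show ?thesis unfolding digraph_iso_def by blast
qed

context one_edge_forest
begin

abbreviation mult :: "'v \<Rightarrow> 'v \<Rightarrow> nat" where
  "mult u v \<equiv> card (between G u v)"

lemma arc_ends: "e \<in> arcs G \<Longrightarrow> tail G e \<in> {r, c, w} \<and> head G e \<in> {r, c, w}"
  using verts_eq tail_in_verts head_in_verts by blast

lemma finite_between [simp]: "finite (between G u v)"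
  by (simp add: between_def)

lemma between_c: "between G u c = (if u = r then {f} else {})"
  using head_c f_arc tail_f head_f by (auto simp: between_def)

lemma carcs_eq:
  "carcs r r = between G r r \<union> between G c r" "carcs r w = between G r w \<union> between G c w"
  "carcs w r = between G w r" "carcs w w = between G w w"
  using head_f distinct by (auto simp: carcs_def between_def cl_def split: if_splits)

lemma card_carcs:
  "card (carcs r r) = mult r r + mult c r" "card (carcs r w) = mult r w + mult c w"
  "card (carcs w r) = mult w r" "card (carcs w w) = mult w w"
  unfolding carcs_eq using distinct by (auto simp: between_def intro!: card_Un_disjoint)

lemma card_class_r: "card {e \<in> arcs G. cl (tail G e) = r} = 1 + card (carcs r r) + card (carcs r w)"
proof -
  have "{e \<in> arcs G. cl (tail G e) = r} = insert f (carcs r r \<union> carcs r w)"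
    using arc_ends head_c f_arc tail_f distinct by (auto simp: carcs_def cl_def)
  moreover have "f \<notin> carcs r r \<union> carcs r w" by (simp add: carcs_def)
  moreover have "finite (carcs r r)" "finite (carcs r w)" by (simp_all add: carcs_def)
  moreover have "carcs r r \<inter> carcs r w = {}" using distinct by (auto simp: carcs_def)
  ultimately show ?thesis by (simp add: card_Un_disjoint)
qed

lemma card_class_w: "card {e \<in> arcs G. cl (tail G e) = w} = card (carcs w r) + card (carcs w w)"
proof -
  have "{e \<in> arcs G. cl (tail G e) = w} = carcs w r \<union> carcs w w"
    using arc_ends head_c f_arc tail_f distinct by (auto simp: carcs_def cl_def split: if_splits)
  moreover have "finite (carcs w r)" "finite (carcs w w)" by (simp_all add: carcs_def)
  moreover have "carcs w r \<inter> carcs w w = {}" using distinct by (auto simp: carcs_def)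
  ultimately show ?thesis by (simp add: card_Un_disjoint)
qed

text \<open>A loop at \<open>c\<close> would be an edge into \<open>c\<close> other than
  \<open>f\<close>.\<close>

lemma card_loops: "card {e \<in> arcs G. tail G e = head G e} = mult r r + mult w w"
proof -
  have "head G e = r \<or> head G e = w" if "e \<in> arcs G" "tail G e = head G e" for e
    using arc_ends[OF that(1)] head_c[OF that(1)] that(2) tail_f distinct by auto
  then have "e \<in> between G r r \<union> between G w w" if "e \<in> {e \<in> arcs G. tail G e = head G e}" for e
    using that by (simp add: between_def)
  then have "{e \<in> arcs G. tail G e = head G e} = between G r r \<union> between G w w"
    by (intro subset_antisym subsetI) (assumption | simp add: between_def, elim disjE, simp_all)+
  moreover have "between G r r \<inter> between G w w = {}" using distinct by (auto simp: between_def)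
  ultimately show ?thesis by (simp add: card_Un_disjoint)
qed

text \<open>Sum the products \<open>mult u v * mult v u\<close> over ordered pairs of vertices. Only
  \<open>f\<close> enters \<open>c\<close>, so \<open>c\<close> contributes just the cycles through
  \<open>r\<close>, once in each order.\<close>

lemma card_two_cycles: "card two_cycles = mult r r * mult r r + mult w w * mult w w + 2 * mult c r + 2 * (mult r w * mult w r)"
proof -
  let ?B = "\<lambda>(u, v). between G u v \<times> between G v u"
  have "two_cycles = (\<Union>p\<in>verts G \<times> verts G. ?B p)"
    by (auto simp: two_cycles_def between_def)
  then have "card two_cycles = (\<Sum>p\<in>verts G \<times> verts G. card (?B p))"
    by (simp only:) (rule card_UN_disjoint, auto simp: between_def)
  also have "\<dots> = (\<Sum>u\<in>verts G. \<Sum>v\<in>verts G. mult u v * mult v u)"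
    by (simp add: sum.cartesian_product card_cartesian_product case_prod_unfold)
  also have "\<dots> = mult r r * mult r r + mult w w * mult w w + 2 * mult c r + 2 * (mult r w * mult w r)"
    unfolding verts_eq using distinct by (simp add: between_c)
  finally show ?thesis .
qed

text \<open>As \<open>c\<close> is entered only from \<open>r\<close>, every way out of
  \<open>w\<close> starts with an edge to \<open>r\<close>. Positivity permits the cancellation that
  isolates \<open>mult r w\<close>.\<close>

lemma mult_w_r_pos: "mult w r > 0"
proof (rule ccontr)
  assume "\<not> mult w r > 0"
  then have "between G w r = {}" by simp
  moreover have "between G w c = {}" using between_c distinct by simp
  ultimately have stay: "head G e = w" if "e \<in> arcs G" "tail G e = w" for e
    using that arc_ends by (auto simp: between_def)
  have "v = w" if "awalk w p v" for p v
    using that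
  proof (induction p)
    case (Cons e p)
    then have "e \<in> arcs G" "tail G e = w" "awalk (head G e) p v" by (auto simp: awalk_simps)
    then show ?case using Cons.IH stay by simp
  qed auto
  moreover obtain p where "awalk w p r" using walk_exists[of w r] verts_eq by auto
  ultimately show False using distinct by auto
qed

end

text \<open>Uniqueness of walks excludes loops, since a loop could be appended to a walk that ends
  at its vertex. Hence \<open>f\<close> joins two different vertices, the one-vertex tree has no
  edge, and the first tree has no vertex besides the ends of \<open>f\<close>.\<close>

lemma one_edge_one_vertex_forestE:
  assumes "fin_digraph G" "strongly_connected G" "one_edge_one_vertex_forest (F_graph G)"
  obtains r c w f where "one_edge_forest G r c w f"
proof -
  interpret G: fin_digraph G by fact
  obtain T1 T2 where T: "subgraph T1 (F_graph G)" "subgraph T2 (F_graph G)" "directed_tree T1" "directed_tree T2"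
    "verts T1 \<inter> verts T2 = {}" "verts T1 \<union> verts T2 = verts G" "arcs T1 \<union> arcs T2 = F_edges G"
    "card (arcs T1) = 1" "card (verts T2) = 1"
    using assms(3) by (auto simp: one_edge_one_vertex_forest_def F_graph_def)
  interpret T1: fin_digraph T1 using T(3) by (simp add: directed_tree_def)
  interpret T2: fin_digraph T2 using T(4) by (simp add: directed_tree_def)
  have ends: "tail T1 = tail G" "head T1 = head G" "tail T2 = tail G" "head T2 = head G"
    using T(1,2) by (auto simp: subgraph_def compatible_def F_graph_def)
  obtain f where f: "arcs T1 = {f}" using T(8) by (auto simp: card_1_singleton_iff)
  obtain w where w: "verts T2 = {w}" using T(9) by (auto simp: card_1_singleton_iff)
  obtain x where x: "x \<in> verts T1" "\<And>v. v \<in> verts T1 \<Longrightarrow> \<exists>!p. T1.awalk x p v"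
    using T(3) by (auto simp: directed_tree_def)
  have fv: "tail G f \<in> verts T1" "head G f \<in> verts T1"
    using T1.tail_in_verts[of f] T1.head_in_verts[of f] f ends by auto
  have ne: "tail G f \<noteq> head G f"
  proof
    assume eq: "tail G f = head G f"
    obtain p where p: "T1.awalk x p (tail G f)" using x(2)[OF fv(1)] by blast
    then have "T1.awalk x (p @ [f]) (tail G f)" using f fv eq by (auto simp: T1.awalk_simps ends)
    then have "p = p @ [f]" using x(2)[OF fv(1)] p by blast
    then show False by simp
  qed
  have only: "v = x \<or> v = head G f" if v: "v \<in> verts T1" for v
  proof -
    obtain p where p: "T1.awalk x p v" using x(2)[OF v] by blast
    show ?thesis
    proof (cases p rule: rev_cases)
      case Nil
      then show ?thesis using p by auto
    next
      case (snoc q e)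
      then have "e \<in> arcs T1" "head G e = v" using p by (auto simp: T1.awalk_simps ends)
      then show ?thesis using f by auto
    qed
  qed
  have "x = tail G f" using only[OF fv(1)] ne by auto
  then have vT1: "verts T1 = {tail G f, head G f}" using only fv by auto
  have aT2: "arcs T2 = {}"
  proof (rule ccontr)
    assume "arcs T2 \<noteq> {}"
    then obtain a where a: "a \<in> arcs T2" by blast
    then have "tail G a = w" "head G a = w" using T2.tail_in_verts[OF a] T2.head_in_verts[OF a] w ends by auto
    then have "T2.awalk w [] w" "T2.awalk w [a] w" using a w by (auto simp: T2.awalk_simps ends)
    moreover have "\<exists>!p. T2.awalk w p w" using T(4) w by (auto simp: directed_tree_def)
    ultimately show False by blast
  qed
  have "one_edge_forest G (tail G f) (head G f) w f"
    by unfold_locales (use T(5-7) vT1 w f aT2 ne assms(2) in auto)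
  then show thesis by (rule that)
qed

lemma conj_arc:
  assumes "one_edge_forest G r c w f" "one_edge_forest G' r' c' w' f'"
    and conj: "shift_conj (MD G) (MD G') \<phi> \<psi> \<rho>" and e: "e \<in> arcs G"
  obtains e' where "e' \<in> arcs G'" "\<phi> (blink e) = blink e' \<or> \<phi> (blink e) = shift (blink e')"
proof -
  interpret G: one_edge_forest G r c w f by fact
  interpret G': one_edge_forest G' r' c' w' f' by fact
  interpret shift_conj "MD G" "MD G'" \<phi> \<psi> \<rho> by fact
  have "\<phi> (blink e) \<in> neut (MD G')" unfolding neut_image using G.blink_neut[OF e] by blast
  then show thesis using G'.neut_cases that by blast
qed

theorem theorem6p1:
  fixes G :: "('v, 'e) pre_digraph" and G' :: "('w, 'f) pre_digraph"
  assumes "fin_digraph G" and "fin_digraph G'"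
    and "strongly_connected G" and "strongly_connected G'"
    and "\<not> is_cycle_graph G" and "\<not> is_cycle_graph G'"
    and "MD_semigroup_of_two_vertex_graph G" and "MD_semigroup_of_two_vertex_graph G'"
    and "one_edge_one_vertex_forest (F_graph G)" and "one_edge_one_vertex_forest (F_graph G')"
    and "topologically_conjugate (MD G) (MD G')"
  shows "digraph_iso G G'"
proof -
  obtain r c w f where L: "one_edge_forest G r c w f"
    using one_edge_one_vertex_forestE assms by blast
  obtain r' c' w' f' where L': "one_edge_forest G' r' c' w' f'"
    using one_edge_one_vertex_forestE assms by blast
  interpret G: one_edge_forest G r c w f by (rule L)
  interpret G': one_edge_forest G' r' c' w' f' by (rule L')
  obtain \<phi> \<psi> \<rho> where conj: "shift_conj (MD G) (MD G') \<phi> \<psi> \<rho>"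
    using topologically_conjugate_imp_shift_conj[OF assms(11) G.shift_invariant_MD G'.shift_invariant_MD
        G.compact_MD G'.compact_MD] .
  interpret shift_conj "MD G" "MD G'" \<phi> \<psi> \<rho> by (rule conj)
  have carcs: "card (G'.carcs (G'.cl (tail G' a')) (G'.cl (tail G' b'))) = card (G.carcs (G.cl (tail G a)) (G.cl (tail G b)))"
    and same: "G'.cl (tail G' a') = G'.cl (tail G' b') \<longleftrightarrow> G.cl (tail G a) = G.cl (tail G b)"
    and size: "card {e \<in> arcs G'. G'.cl (tail G' e) = G'.cl (tail G' a')} = card {e \<in> arcs G. G.cl (tail G e) = G.cl (tail G a)}"
    if a: "a \<in> arcs G" "a' \<in> arcs G'" "\<phi> (blink a) = blink a' \<or> \<phi> (blink a) = shift (blink a')"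
      and b: "b \<in> arcs G" "b' \<in> arcs G'" "\<phi> (blink b) = blink b' \<or> \<phi> (blink b) = shift (blink b')" for a b a' b'
  proof -
    have "arrows (MD G') (\<phi> (blink a)) (\<phi> (blink b)) = arrows (MD G') (blink a') (blink b')"
      using a(3) b(3) by (auto simp: arrows_shift)
    then show "card (G'.carcs (G'.cl (tail G' a')) (G'.cl (tail G' b'))) = card (G.carcs (G.cl (tail G a)) (G.cl (tail G b)))"
      using card_arrows[OF G.blink_MD[OF a(1)] G.blink_MD[OF b(1)]]
        G.card_arrows_blink[OF a(1) b(1)] G'.card_arrows_blink[OF a(2) b(2)] by simp
    have "eqv (MD G') (\<phi> (blink a)) (\<phi> (blink b)) = eqv (MD G') (blink a') (blink b')"
      using a(3) b(3) by (auto simp: eqv_shift)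
    then show "G'.cl (tail G' a') = G'.cl (tail G' b') \<longleftrightarrow> G.cl (tail G a) = G.cl (tail G b)"
      using eqv_iff[OF G.blink_MD[OF a(1)] G.blink_MD[OF b(1)]] G.eqv_blink[OF a(1) b(1)] G'.eqv_blink[OF a(2) b(2)] by simp
    have "{q \<in> neut (MD G'). eqv (MD G') q (\<phi> (blink a))} = {q \<in> neut (MD G'). eqv (MD G') q (blink a')}"
      using a(3) by (auto simp: eqv_shift)
    then show "card {e \<in> arcs G'. G'.cl (tail G' e) = G'.cl (tail G' a')} = card {e \<in> arcs G. G.cl (tail G e) = G.cl (tail G a)}"
      using card_eqv[OF G.blink_MD[OF a(1)]] G.card_eqv_blink[OF a(1)] G'.card_eqv_blink[OF a(2)] by simp
  qed
  \<comment> \<open>One edge represents each tree: \<open>f\<close> that of \<open>r\<close>, and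
    \<open>a\<close> that of \<open>w\<close>. The trees \<open>A\<close> and \<open>B\<close> of
    their partners in \<open>G'\<close> are still to be matched with \<open>r'\<close> and
    \<open>w'\<close>.\<close>
  obtain a where a: "a \<in> arcs G" "tail G a = w" using G.out_arc[of w] G.verts_eq by auto
  obtain f1 where f1: "f1 \<in> arcs G'" "\<phi> (blink f) = blink f1 \<or> \<phi> (blink f) = shift (blink f1)"
    using conj_arc[OF L L' conj G.f_arc] .
  obtain a1 where a1: "a1 \<in> arcs G'" "\<phi> (blink a) = blink a1 \<or> \<phi> (blink a) = shift (blink a1)"
    using conj_arc[OF L L' conj a(1)] .
  define A where "A = G'.cl (tail G' f1)"
  define B where "B = G'.cl (tail G' a1)"
  have clG: "G.cl (tail G f) = r" "G.cl (tail G a) = w"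
    using G.tail_f a(2) G.distinct by (auto simp: G.cl_def)
  note F = G.f_arc f1 and W = a(1) a1
  have AB: "A \<noteq> B" "A \<in> {r', w'}" "B \<in> {r', w'}"
    using same[OF F W] G.distinct clG G'.cl_verts f1(1) a1(1) by (auto simp: A_def B_def)
  have c: "card (G'.carcs A A) = card (G.carcs r r)" "card (G'.carcs A B) = card (G.carcs r w)"
    "card (G'.carcs B A) = card (G.carcs w r)" "card (G'.carcs B B) = card (G.carcs w w)"
    using carcs[OF F F] carcs[OF F W] carcs[OF W F] carcs[OF W W] by (simp_all add: A_def B_def clG)
  have s: "card {e \<in> arcs G'. G'.cl (tail G' e) = A} = 1 + card (G.carcs r r) + card (G.carcs r w)"
    using size[OF F F] G.card_class_r by (simp add: A_def clG)
  \<comment> \<open>The class of the root \<open>r\<close> also contains \<open>f\<close>, an edge that is not among the arrows.\<close>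
  have "A \<noteq> w'"
  proof
    assume "A = w'"
    then have "B = r'" using AB by auto
    then show False using s c G'.card_class_w \<open>A = w'\<close> by simp
  qed
  then have "A = r'" "B = w'" using AB by auto
  note c = c[unfolded this G.card_carcs G'.card_carcs]
  \<comment> \<open>The loops at \<open>w\<close> are already known from the contracted graph, so
    the count of fixed points isolates those at \<open>r\<close>.\<close>
  have "G'.mult r' r' + G'.mult w' w' = G.mult r r + G.mult w w"
    using card_fixed unfolding G.card_fixed_MD G'.card_fixed_MD G.card_loops G'.card_loops by simp
  then have rr: "G'.mult r' r' = G.mult r r" using c(4) by simp
  then have cr: "G'.mult c' r' = G.mult c r" using c(1) by simp
  \<comment> \<open>All terms of this count are known by now except the product of the edge numbers
    between \<open>r\<close> and \<open>w\<close>.\<close>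
  have "card G'.two_cycles = card G.two_cycles"
    using card_period2 unfolding G.card_period2_MD G'.card_period2_MD by simp
  then have "G'.mult r' w' * G'.mult w' r' = G.mult r w * G.mult w r"
    unfolding G.card_two_cycles G'.card_two_cycles rr cr c(4) by simp
  then have rw: "G'.mult r' w' = G.mult r w" using c(3) G.mult_w_r_pos by (metis less_irrefl mult_cancel2)
  then have cw: "G'.mult c' w' = G.mult c w" using c(2) by simp
  define \<pi> where "\<pi> x = (if x = r then r' else if x = c then c' else w')" for x
  have \<pi>: "\<pi> r = r'" "\<pi> c = c'" "\<pi> w = w'" using G.distinct by (auto simp: \<pi>_def)
  show ?thesis
  proof (rule digraph_isoI[OF assms(1,2)])
    show "inj_on \<pi> (verts G)" "\<pi> ` verts G = verts G'"
      using \<pi> G'.distinct unfolding G.verts_eq G'.verts_eq by (auto simp: inj_on_def)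
    fix u v assume "u \<in> verts G" "v \<in> verts G"
    then show "G.mult u v = G'.mult (\<pi> u) (\<pi> v)"
      using G.distinct G'.distinct rr cr rw cw c(3,4) unfolding G.verts_eq
      by (auto simp: \<pi> G.between_c G'.between_c)
  qed
qed

end
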